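(* Let $K$ be a field (possibly finite) and let $\mathbf m$ be an ideal of $K[z,x,y]$ of finite codimension (i.e. $\dim_K K[z,x,y]/\mathbf m<\infty$). Then neither of the groups $\mathrm{Aut}_{\mathbf m}\,\mathbb{A}^3_K$ and $\mathrm{TAut}_{\mathbf m}\,\mathbb{A}^3_K$ is linear, even over a ring; that is, neither group admits an injective homomorphism into $\mathrm{GL}(n,R)$ for any integer $n\geq 1$ and any commutative ring $R$.
   Context: $\mathrm{Aut}\,\mathbb{A}^3_K$ is the group of polynomial automorphisms of affine 3-space over $K$ with coordinates $(z,x,y)$, i.e. triples of (formal) polynomials in $K[z,x,y]$ invertible under composition. $\mathrm{Aut}_{\mathbf m}\,\mathbb{A}^3_K$ is the group of all polynomial automorphisms of the form $(z,x,y)\mapsto(z+f,x+g,y+h)$ with $f,g,h\in\mathbf m$. The group of tame automorphisms $\mathrm{TAut}\,\mathbb{A}^3_K$ is the subgroup of $\mathrm{Aut}\,\mathbb{A}^3_K$ generated by the group $\mathrm{Aff}(3,K)$ of affine automorphisms of $\mathbb{A}^3_K$ and the group $T(3,K)$ of all triangular automorphisms $(z,x,y)\mapsto(z,x+f(z),y+g(z,x))$ with $f,g$ polynomials. $\mathrm{TAut}_{\mathbf m}\,\mathbb{A}^3_K=\mathrm{TAut}\,\mathbb{A}^3_K\cap\mathrm{Aut}_{\mathbf m}\,\mathbb{A}^3_K$. Rings are associative, commutative and unital. *)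

theory Defs
  imports
    "HOL-Algebra.Algebra"
    "HOL-Algebra.Algebraic_Closure_Type"
    "HOL-Computational_Algebra.Polynomial"
begin

text \<open>
  The polynomial ring \<open>K[z,x,y]\<close> is rendered as \<open>K[z][x][y]\<close>: the innermost
  variable is \<open>z\<close>, the outermost one is \<open>y\<close>.  Hence \<open>[:[:f:]:]\<close> is an element \<open>f\<close> of \<open>K[z]\<close>
  and \<open>[:g:]\<close> is an element \<open>g\<close> of \<open>K[z,x]\<close>, both viewed in \<open>K[z,x,y]\<close>.
\<close>

type_synonym 'k poly3 = "'k poly poly poly"

definition const3 :: "'k::field \<Rightarrow> 'k poly3"
  where "const3 c = [:[:[:c:]:]:]"

definition var_z :: "'k::field poly3"
  where "var_z = [:[:[:0, 1:]:]:]"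

definition var_x :: "'k::field poly3"
  where "var_x = [:[:0, 1:]:]"

definition var_y :: "'k::field poly3"
  where "var_y = [:0, 1:]"

text \<open>\<open>subst3 (f, g, h) p\<close> is \<open>p(f, g, h)\<close>, i.e. \<open>p\<close> with \<open>z := f\<close>, \<open>x := g\<close>, \<open>y := h\<close>.\<close>

definition subst3 :: "'k::field poly3 \<times> 'k poly3 \<times> 'k poly3 \<Rightarrow> 'k poly3 \<Rightarrow> 'k poly3"
  where "subst3 = (\<lambda>(f, g, h) p.
    poly (map_poly (\<lambda>q. poly (map_poly (\<lambda>r. poly (map_poly const3 r) f) q) g) p) h)"

text \<open>
  A triple \<open>(f, g, h)\<close> stands for the polynomial endomorphism \<open>(z,x,y) \<mapsto> (f, g, h)\<close>;
  the product is composition of maps, \<open>(\<phi> \<circ> \<psi>)(z,x,y) = \<phi>(\<psi>(z,x,y))\<close>.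
\<close>

definition End_A3 :: "('k::field poly3 \<times> 'k poly3 \<times> 'k poly3) monoid"
  where "End_A3 =
    \<lparr>carrier = UNIV,
     monoid.mult = (\<lambda>\<phi> \<psi>. case \<phi> of (f, g, h) \<Rightarrow> (subst3 \<psi> f, subst3 \<psi> g, subst3 \<psi> h)),
     one = (var_z, var_x, var_y)\<rparr>"

definition Aut_A3 :: "('k::field poly3 \<times> 'k poly3 \<times> 'k poly3) monoid"
  where "Aut_A3 = units_of End_A3"

definition affine_poly3 :: "'k::field poly3 \<Rightarrow> bool"
  where "affine_poly3 p \<longleftrightarrow> (\<exists>a b c d.
    p = const3 a * var_z + const3 b * var_x + const3 c * var_y + const3 d)"

text \<open>The inverse of an automorphism with affine components is again affine, so this is \<open>Aff(3,K)\<close>.\<close>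

definition Aff3 :: "('k::field poly3 \<times> 'k poly3 \<times> 'k poly3) set"
  where "Aff3 = {(f, g, h). (f, g, h) \<in> carrier Aut_A3 \<and>
    affine_poly3 f \<and> affine_poly3 g \<and> affine_poly3 h}"

definition Triangular3 :: "('k::field poly3 \<times> 'k poly3 \<times> 'k poly3) set"
  where "Triangular3 = {(var_z, var_x + [:[:f:]:], var_y + [:g:]) | f g. True}"

definition TAut_A3_set :: "('k::field poly3 \<times> 'k poly3 \<times> 'k poly3) set"
  where "TAut_A3_set = generate Aut_A3 (Aff3 \<union> Triangular3)"

definition Aut_mod_set ::
    "'k::field poly3 set \<Rightarrow> ('k poly3 \<times> 'k poly3 \<times> 'k poly3) set"
  where "Aut_mod_set \<mm> =
    carrier Aut_A3 \<inter> {(var_z + f, var_x + g, var_y + h) | f g h. f \<in> \<mm> \<and> g \<in> \<mm> \<and> h \<in> \<mm>}"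

definition Aut_mod ::
    "'k::field poly3 set \<Rightarrow> ('k poly3 \<times> 'k poly3 \<times> 'k poly3) monoid"
  where "Aut_mod \<mm> = Aut_A3\<lparr>carrier := Aut_mod_set \<mm>\<rparr>"

definition TAut_mod ::
    "'k::field poly3 set \<Rightarrow> ('k poly3 \<times> 'k poly3 \<times> 'k poly3) monoid"
  where "TAut_mod \<mm> = Aut_A3\<lparr>carrier := TAut_A3_set \<inter> Aut_mod_set \<mm>\<rparr>"

definition poly3_ring :: "'k::field poly3 ring"
  where "poly3_ring = ring_of_type_algebra"

text \<open>
  The scalars acting on \<open>K[z,x,y] / \<mm>\<close> are the cosets of the constants.  If \<open>\<mm>\<close> is the whole ring,
  the quotient is the zero ring, which has dimension \<open>0\<close> in the sense of \<^const>\<open>ring.dimension\<close>.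
\<close>

definition finite_codim :: "'k::field poly3 set \<Rightarrow> bool"
  where "finite_codim \<mm> \<longleftrightarrow>
    ring.finite_dimension (poly3_ring Quot \<mm>)
      (range (\<lambda>c. \<mm> +>\<^bsub>poly3_ring\<^esub> const3 c)) (carrier (poly3_ring Quot \<mm>))"

text \<open>
  \<open>n \<times> n\<close> matrices over \<open>R\<close> are extensional functions on index pairs, so that equality of
  matrices is equality of entries; \<open>GL n R\<close> is the unit group of the monoid of matrices.
\<close>

definition Mat_monoid :: "nat \<Rightarrow> ('r, 'b) ring_scheme \<Rightarrow> (nat \<times> nat \<Rightarrow> 'r) monoid"
  where "Mat_monoid n R =
    \<lparr>carrier = {..<n} \<times> {..<n} \<rightarrow>\<^sub>E carrier R,
     monoid.mult = (\<lambda>A B. \<lambda>(i, j) \<in> {..<n} \<times> {..<n}. \<Oplus>\<^bsub>R\<^esub>k\<in>{..<n}. A (i, k) \<otimes>\<^bsub>R\<^esub> B (k, j)),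
     one = (\<lambda>(i, j) \<in> {..<n} \<times> {..<n}. if i = j then \<one>\<^bsub>R\<^esub> else \<zero>\<^bsub>R\<^esub>)\<rparr>"

definition GL :: "nat \<Rightarrow> ('r, 'b) ring_scheme \<Rightarrow> (nat \<times> nat \<Rightarrow> 'r) monoid"
  where "GL n R = units_of (Mat_monoid n R)"

end

theory Submission
  imports Defs "HOL-Library.Product_Plus"
begin

text \<open>
  It suffices to treat \<open>TAut_mod \<mm>\<close>, which is contained in \<open>Aut_mod \<mm>\<close>. The ideal \<open>\<mm>\<close> contains some
  \<open>P \<in> K[z]\<close> of positive degree, so the group contains the translations
  \<open>(z, x + P a(z), y + P b(z))\<close>, the maps \<open>(z, x, y + P g(z,x))\<close> for all \<open>g \<in> K[z,x]\<close>, and the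
  shear \<open>(z, x + P y, y)\<close>. These elements already contradict linearity.

  The only fact about matrices that is used is an integrality statement which holds over every
  commutative ring: for \<open>s \<in> GL(n,R)\<close>, conjugation by \<open>s\<close> on the free module of all \<open>n \<times> n\<close>
  matrices satisfies a monic polynomial whose degree \<open>D\<close> depends on \<open>n\<close> only
  (\<open>linear_rep_of_matrices\<close>).

  \<^bold>\<open>Characteristic \<open>p > 0\<close>.\<close> Choose a tame \<open>s\<close> acting on translations by a hyperbolic matrix and let
  \<open>e\<^sub>i\<close> be the conjugate by \<open>s\<^sup>i\<close> of one fixed translation. By integrality \<open>e\<^sub>D\<close> is a combination of
  \<open>e\<^sub>0, \<dots>, e\<^sub>D\<^sub>-\<^sub>1\<close> with central coefficients, hence whatever commutes with these commutes with \<open>e\<^sub>D\<close>. But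
  the \<open>x\<close>-components of \<open>e\<^sub>0, \<dots>, e\<^sub>D\<^sub>-\<^sub>1\<close> span a finite group \<open>E \<subseteq> K[z]\<close> over the prime field, and
  \<open>g = \<Prod>\<^bsub>u \<in> E\<^esub> (x - u)\<close> is invariant under translation by each of them, but not under that of \<open>e\<^sub>D\<close>,
  whose degree is larger (\<open>positive_characteristic_impossible\<close>).

  \<^bold>\<open>Characteristic 0.\<close> Here integrality is combined with Dedekind's elimination argument for
  characters. If \<open>s\<close> normalizes a commutative group, then a monic relation for
  conjugation by \<open>s\<close> forces the vanishing of a product of \<open>D\<close> factors \<open>u - 1\<close>, where the elements \<open>u\<close>
  are commutators with powers of \<open>s\<close> (\<open>unipotent_product\<close>). With \<open>s\<close> the shear this shows that the translation
  \<open>t: x \<mapsto> x + P\<^sup>2\<close> satisfies \<open>(t - 1)\<^sup>D = 0\<close>. Conjugation by \<open>t\<close> is then unipotent as well, and a second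
  application of the same argument shows that sufficiently divisible maps \<open>y + P g(z,x)\<close> are
  unipotent of bounded index. Two such bounds force the iterated commutators of these maps with \<open>t\<close> to become
  trivial after a number of steps that depends on \<open>D\<close> only (\<open>nilpotent_action_bound\<close>). On
  polynomials these commutators are iterated differences in \<open>x\<close>, which lower the degree by exactly
  one each time, so that no such bound exists (\<open>characteristic_zero_impossible\<close>).
\<close>

section \<open>All rings on a type as a single ring\<close>

text \<open>
  The calculations below take place in the matrix ring over a commutative ring \<open>R\<close>, whose carrier is a term and
  not a type. The product of all rings with carrier in \<open>'a\<close> is a single ring whose carrier is a
  type, and every such ring is a direct factor of it. It need not satisfy \<open>0 \<noteq> 1\<close> (take a type
  with one element), hence the sort.
\<close>
typedef 'a all_rings =
  "{F :: 'a ring \<Rightarrow> 'a. \<forall>S. if ring S then F S \<in> carrier S else F S = undefined}"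
  by (rule exI[of _ "\<lambda>S. if ring S then \<zero>\<^bsub>S\<^esub> else undefined"]) (auto intro: ring.ring_simprules)

setup_lifting type_definition_all_rings

lift_definition coord :: "'a ring \<Rightarrow> 'a all_rings \<Rightarrow> 'a" is "\<lambda>S F. F S" .

lemma coord_closed: "ring S \<Longrightarrow> coord S x \<in> carrier S"
  by transfer metis

lemma all_rings_eqI: "(\<And>S. ring S \<Longrightarrow> coord S x = coord S y) \<Longrightarrow> x = y"
  by transfer (rule ext, metis)

instantiation all_rings :: (type) "{ring, monoid_mult}"
begin

lift_definition zero_all_rings :: "'a all_rings"
  is "\<lambda>S. if ring S then \<zero>\<^bsub>S\<^esub> else undefined"
  by (auto intro: ring.ring_simprules)
lift_definition one_all_rings :: "'a all_rings"
  is "\<lambda>S. if ring S then \<one>\<^bsub>S\<^esub> else undefined"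
  by (auto intro: ring.ring_simprules)
lift_definition plus_all_rings :: "'a all_rings \<Rightarrow> 'a all_rings \<Rightarrow> 'a all_rings"
  is "\<lambda>F G S. if ring S then F S \<oplus>\<^bsub>S\<^esub> G S else undefined"
  by (auto intro!: ring.ring_simprules)
lift_definition times_all_rings :: "'a all_rings \<Rightarrow> 'a all_rings \<Rightarrow> 'a all_rings"
  is "\<lambda>F G S. if ring S then F S \<otimes>\<^bsub>S\<^esub> G S else undefined"
  by (auto intro!: ring.ring_simprules)
lift_definition uminus_all_rings :: "'a all_rings \<Rightarrow> 'a all_rings"
  is "\<lambda>F S. if ring S then \<ominus>\<^bsub>S\<^esub> F S else undefined"
  by (auto intro!: ring.ring_simprules)
lift_definition minus_all_rings :: "'a all_rings \<Rightarrow> 'a all_rings \<Rightarrow> 'a all_rings"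
  is "\<lambda>F G S. if ring S then F S \<ominus>\<^bsub>S\<^esub> G S else undefined"
  by (auto intro!: ring.ring_simprules)

lemma coord_simps:
  assumes "ring S"
  shows "coord S 0 = \<zero>\<^bsub>S\<^esub>" "coord S 1 = \<one>\<^bsub>S\<^esub>"
    "coord S (x + y) = coord S x \<oplus>\<^bsub>S\<^esub> coord S y"
    "coord S (x * y) = coord S x \<otimes>\<^bsub>S\<^esub> coord S y"
    "coord S (- x) = \<ominus>\<^bsub>S\<^esub> coord S x"
    "coord S (x - y) = coord S x \<ominus>\<^bsub>S\<^esub> coord S y"
  using assms by (transfer, simp)+

instance
proof
  fix a b c :: "'a all_rings"
  note [simp] = coord_simps coord_closed ring.ring_simprules monoid.r_one[OF ring.is_monoid]
  show "a * b * c = a * (b * c)" by (rule all_rings_eqI) simp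
  show "1 * a = a" "a * 1 = a" by (rule all_rings_eqI, simp)+
  show "a + b + c = a + (b + c)" by (rule all_rings_eqI) simp
  show "a + b = b + a" by (rule all_rings_eqI) simp
  show "0 + a = a" by (rule all_rings_eqI) simp
  show "- a + a = 0" by (rule all_rings_eqI) simp
  show "a - b = a + - b" by (rule all_rings_eqI) (simp add: ring.ring_simprules(14))
  show "(a + b) * c = a * c + b * c" "a * (b + c) = a * b + a * c"
    by (rule all_rings_eqI, simp)+
qed

end

text \<open>
  The embedding of the factor \<open>S\<close>. It respects sums and products but sends \<open>1\<close> to a central
  idempotent.
\<close>
lift_definition at_ring :: "'a ring \<Rightarrow> 'a \<Rightarrow> 'a all_rings"
  is "\<lambda>S x S'. if ring S' then if S' = S \<and> x \<in> carrier S then x else \<zero>\<^bsub>S'\<^esub> else undefined"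
  by (auto intro: ring.ring_simprules)

lemma coord_at_ring:
  "ring S' \<Longrightarrow> coord S' (at_ring S x) = (if S' = S \<and> x \<in> carrier S then x else \<zero>\<^bsub>S'\<^esub>)"
  by transfer simp

lemma at_ring_simps:
  assumes "ring S" "x \<in> carrier S" "y \<in> carrier S"
  shows "at_ring S (x \<oplus>\<^bsub>S\<^esub> y) = at_ring S x + at_ring S y"
    "at_ring S (x \<otimes>\<^bsub>S\<^esub> y) = at_ring S x * at_ring S y"
  using assms
  by (auto intro!: all_rings_eqI simp: coord_at_ring coord_simps ring.ring_simprules)

lemma at_ring_zero: "ring S \<Longrightarrow> at_ring S \<zero>\<^bsub>S\<^esub> = 0"
  by (auto intro!: all_rings_eqI simp: coord_at_ring coord_simps ring.ring_simprules)

lemma at_ring_one_central: "ring S \<Longrightarrow> (at_ring S (one S)) * x = x * (at_ring S (one S))"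
  by (auto intro!: all_rings_eqI
      simp: coord_at_ring coord_simps ring.ring_simprules coord_closed monoid.r_one[OF ring.is_monoid])

lemma at_ring_finsum:
  assumes S: "ring S" and "finite I" and "\<And>i. i \<in> I \<Longrightarrow> f i \<in> carrier S"
  shows "at_ring S (finsum S f I) = (\<Sum>i\<in>I. at_ring S (f i))"
  using assms(2,3)
proof (induction I rule: finite_induct)
  case empty
  interpret ring S by fact
  show ?case by (simp add: at_ring_zero S)
next
  case (insert i I)
  interpret ring S by fact
  have "finsum S f (insert i I) = f i \<oplus>\<^bsub>S\<^esub> finsum S f I"
    by (rule finsum_insert) (use insert in auto)
  then show ?case using insert by (simp add: at_ring_simps S Pi_def)
qed

section \<open>Conjugation of matrices is integral\<close>

definition central :: "'a::times \<Rightarrow> bool"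
  where "central c \<longleftrightarrow> (\<forall>x. c * x = x * c)"

text \<open>
  For an operator \<open>\<phi>\<close>, \<open>low \<phi> d\<close> consists of the operators \<open>q(\<phi>)\<close> with \<open>q\<close> a polynomial of degree less
  than \<open>d\<close> with central coefficients, and \<open>monic \<phi> d\<close> of those with \<open>q\<close> monic of degree \<open>d\<close>. Working
  with the operators, for which degrees are mere upper bounds, avoids polynomials over a set
  of central elements that is not a type.
\<close>
fun low :: "('a::{ring,monoid_mult} \<Rightarrow> 'a) \<Rightarrow> nat \<Rightarrow> ('a \<Rightarrow> 'a) set" where
  "low \<phi> 0 = {\<lambda>_. 0}"
| "low \<phi> (Suc d) = {\<lambda>v. c * v + \<phi> (f v) | c f. central c \<and> f \<in> low \<phi> d}"

definition monic :: "('a::{ring,monoid_mult} \<Rightarrow> 'a) \<Rightarrow> nat \<Rightarrow> ('a \<Rightarrow> 'a) set" where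
  "monic \<phi> d = {\<lambda>v. (\<phi> ^^ d) v + f v | f. f \<in> low \<phi> d}"

lemma central_0 [simp]: "central (0::'a::{ring,monoid_mult})" 
  and central_1 [simp]: "central (1::'a::{ring,monoid_mult})"
  by (auto simp: central_def)

lemma central_add: "central (c::'a::ring) \<Longrightarrow> central d \<Longrightarrow> central (c + d)"
  by (auto simp: central_def algebra_simps)
lemma central_minus: "central (c::'a::ring) \<Longrightarrow> central (- c)"
  by (auto simp: central_def)
lemma central_mult: "central (c::'a::ring) \<Longrightarrow> central d \<Longrightarrow> central (c * d)"
  unfolding central_def by (metis mult.assoc)

locale operator =
  fixes \<phi> :: "'a::{ring,monoid_mult} \<Rightarrow> 'a"
  assumes add: "\<phi> (u + v) = \<phi> u + \<phi> v"
    and scale: "central c \<Longrightarrow> \<phi> (c * v) = c * \<phi> v"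
begin

lemma zero: "\<phi> 0 = 0"
  using add[of 0 0] by simp

lemma funpow_add: "(\<phi> ^^ k) (u + v) = (\<phi> ^^ k) u + (\<phi> ^^ k) v"
  by (induction k) (auto simp: add)

lemma low_SucI: "central c \<Longrightarrow> f \<in> low \<phi> d \<Longrightarrow> (\<lambda>v. c * v + \<phi> (f v)) \<in> low \<phi> (Suc d)"
  by auto

lemma low_add: "f \<in> low \<phi> d \<Longrightarrow> g \<in> low \<phi> d \<Longrightarrow> (\<lambda>v. f v + g v) \<in> low \<phi> d"
proof (induction d arbitrary: f g)
  case (Suc d)
  then obtain c f' e g' where *: "f = (\<lambda>v. c * v + \<phi> (f' v))" "g = (\<lambda>v. e * v + \<phi> (g' v))"
    "central c" "central e" "f' \<in> low \<phi> d" "g' \<in> low \<phi> d" by auto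
  have "(\<lambda>v. f v + g v) = (\<lambda>v. (c + e) * v + \<phi> (f' v + g' v))"
    by (auto simp: * add algebra_simps)
  moreover have "(\<lambda>v. f' v + g' v) \<in> low \<phi> d" by (rule Suc.IH) fact+
  ultimately show ?case using central_add[OF *(3,4)] by auto
qed auto

lemma low_scale: "f \<in> low \<phi> d \<Longrightarrow> central z \<Longrightarrow> (\<lambda>v. z * f v) \<in> low \<phi> d"
proof (induction d arbitrary: f)
  case (Suc d)
  then obtain c f' where *: "f = (\<lambda>v. c * v + \<phi> (f' v))" "central c" "f' \<in> low \<phi> d" by auto
  have "(\<lambda>v. z * f v) = (\<lambda>v. (z * c) * v + \<phi> (z * f' v))"
    by (auto simp: * scale Suc.prems algebra_simps)
  moreover have "(\<lambda>v. z * f' v) \<in> low \<phi> d" by (rule Suc.IH) fact+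
  ultimately show ?case using central_mult[OF Suc.prems(2) *(2)] by auto
qed auto

lemma low_minus: "f \<in> low \<phi> d \<Longrightarrow> (\<lambda>v. - f v) \<in> low \<phi> d"
  using low_scale[of f d "- 1"] by (simp add: central_minus)

lemma low_zero: "(\<lambda>_. 0) \<in> low \<phi> d"
proof (induction d)
  case (Suc d)
  show ?case using low_SucI[OF central_0 Suc] by (simp add: zero)
qed auto

lemma low_shift: "f \<in> low \<phi> d \<Longrightarrow> (\<lambda>v. \<phi> (f v)) \<in> low \<phi> (Suc d)"
  using low_SucI[OF central_0, of f d] by simp

lemma low_const: "central c \<Longrightarrow> (\<lambda>v. c * v) \<in> low \<phi> (Suc 0)"
  using low_SucI[of c "\<lambda>_. 0" 0] by (simp add: zero)

lemma low_Suc: "f \<in> low \<phi> d \<Longrightarrow> f \<in> low \<phi> (Suc d)"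
proof (induction d arbitrary: f)
  case 0
  then show ?case using low_zero[of "Suc 0"] by simp
next
  case (Suc d)
  then obtain c f' where *: "f = (\<lambda>v. c * v + \<phi> (f' v))" "central c" "f' \<in> low \<phi> d" by auto
  show ?case unfolding low.simps(2)[of \<phi> "Suc d"] using Suc.IH[OF *(3)] * by blast
qed

lemma low_mono: "f \<in> low \<phi> d \<Longrightarrow> d \<le> e \<Longrightarrow> f \<in> low \<phi> e"
  by (induction e) (use low_Suc le_Suc_eq in blast)+

lemma low_additive: "f \<in> low \<phi> d \<Longrightarrow> f (u + v) = f u + f v"
proof (induction d arbitrary: f)
  case (Suc d)
  then obtain c f' where *: "f = (\<lambda>v. c * v + \<phi> (f' v))" "central c" "f' \<in> low \<phi> d" by auto
  show ?case using Suc.IH[OF *(3)] by (simp add: * add algebra_simps)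
qed auto

lemma low_central: "f \<in> low \<phi> d \<Longrightarrow> central z \<Longrightarrow> f (z * v) = z * f v"
proof (induction d arbitrary: f)
  case (Suc d)
  then obtain c f' where *: "f = (\<lambda>v. c * v + \<phi> (f' v))" "central c" "f' \<in> low \<phi> d" by auto
  have "c * (z * v) = z * (c * v)" using \<open>central z\<close> *(2) by (metis central_def mult.assoc)
  then show ?case using Suc.IH[OF *(3)] Suc.prems(2) by (simp add: * scale algebra_simps)
qed auto

lemma low_commute_\<phi>: "f \<in> low \<phi> d \<Longrightarrow> f (\<phi> v) = \<phi> (f v)"
proof (induction d arbitrary: f)
  case (Suc d)
  then obtain c f' where *: "f = (\<lambda>v. c * v + \<phi> (f' v))" "central c" "f' \<in> low \<phi> d" by auto
  then show ?case using Suc.IH[OF *(3)] by (simp add: * scale add)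
qed (auto simp: zero)

lemma low_commute_pow: "f \<in> low \<phi> d \<Longrightarrow> f ((\<phi> ^^ k) v) = (\<phi> ^^ k) (f v)"
  by (induction k) (auto simp: low_commute_\<phi>)

lemma low_commute: "f \<in> low \<phi> d \<Longrightarrow> g \<in> low \<phi> e \<Longrightarrow> f (g v) = g (f v)"
proof (induction d arbitrary: f)
  case 0
  then show ?case using low_additive[OF 0(2), of 0 0] by auto
next
  case (Suc d)
  then obtain c f' where *: "f = (\<lambda>v. c * v + \<phi> (f' v))" "central c" "f' \<in> low \<phi> d" by auto
  show ?case using Suc.IH[OF *(3) Suc.prems(2)]
    by (simp add: * low_additive[OF Suc.prems(2)] low_central[OF Suc.prems(2)]
        low_commute_\<phi>[OF Suc.prems(2)])
qed

lemma low_pow: "g \<in> low \<phi> e \<Longrightarrow> (\<lambda>v. (\<phi> ^^ k) (g v)) \<in> low \<phi> (k + e)"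
  by (induction k) (use low_shift in fastforce)+

lemma low_comp: "f \<in> low \<phi> d \<Longrightarrow> g \<in> low \<phi> e \<Longrightarrow> (\<lambda>v. f (g v)) \<in> low \<phi> (d + e)"
proof (induction d arbitrary: f)
  case 0
  then show ?case using low_zero[of e] by auto
next
  case (Suc d)
  then obtain c f' where *: "f = (\<lambda>v. c * v + \<phi> (f' v))" "central c" "f' \<in> low \<phi> d" by auto
  have "(\<lambda>v. c * g v) \<in> low \<phi> (Suc d + e)"
    using low_mono[OF low_scale[OF Suc.prems(2) *(2)], of "Suc d + e"] by simp
  moreover have "(\<lambda>v. \<phi> (f' (g v))) \<in> low \<phi> (Suc d + e)"
    using low_shift[OF Suc.IH[OF *(3) Suc.prems(2)]] by simp
  ultimately show ?case unfolding * using low_add by blast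
qed

lemma monic_low: "m \<in> monic \<phi> d \<Longrightarrow> m \<in> low \<phi> (Suc d)"
proof -
  assume "m \<in> monic \<phi> d"
  then obtain f where f: "f \<in> low \<phi> d" "m = (\<lambda>v. (\<phi> ^^ d) v + f v)" by (auto simp: monic_def)
  have "(\<lambda>v. (\<phi> ^^ d) (1 * v)) \<in> low \<phi> (d + Suc 0)" by (rule low_pow[OF low_const]) simp
  then show ?thesis using low_add[OF _ low_Suc[OF f(1)]] f(2) by simp
qed

lemma monic_comp_low:
  assumes "m \<in> monic \<phi> d" "g \<in> low \<phi> e" shows "(\<lambda>v. m (g v)) \<in> low \<phi> (d + e)"
proof -
  obtain f where f: "f \<in> low \<phi> d" "m = (\<lambda>v. (\<phi> ^^ d) v + f v)" using assms by (auto simp: monic_def)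
  show ?thesis unfolding f using low_add[OF low_pow[OF assms(2)] low_comp[OF f(1) assms(2)]] by simp
qed

lemma monic_add_low: "m \<in> monic \<phi> d \<Longrightarrow> g \<in> low \<phi> d \<Longrightarrow> (\<lambda>v. m v + g v) \<in> monic \<phi> d"
  unfolding monic_def using low_add by (fastforce simp: add.assoc)

lemma monic_comp:
  assumes "m \<in> monic \<phi> d" "m' \<in> monic \<phi> e" shows "(\<lambda>v. m (m' v)) \<in> monic \<phi> (d + e)"
proof -
  obtain f where f: "f \<in> low \<phi> e" "m' = (\<lambda>v. (\<phi> ^^ e) v + f v)" using assms by (auto simp: monic_def)
  obtain g where g: "g \<in> low \<phi> d" "m = (\<lambda>v. (\<phi> ^^ d) v + g v)" using assms by (auto simp: monic_def)
  have "(\<lambda>v. (\<phi> ^^ e) (g v)) \<in> low \<phi> (d + e)" using low_pow[OF g(1), of e] by (simp add: add.commute)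
  then have "(\<lambda>v. g ((\<phi> ^^ e) v)) \<in> low \<phi> (d + e)" by (simp add: low_commute_pow[OF g(1)])
  from low_add[OF this monic_comp_low[OF assms(1) f(1)]]
  have "(\<lambda>v. g ((\<phi> ^^ e) v) + m (f v)) \<in> low \<phi> (d + e)" .
  moreover have "m (m' v) = (\<phi> ^^ (d + e)) v + (g ((\<phi> ^^ e) v) + m (f v))" for v
    using low_additive[OF monic_low[OF assms(1)], of "(\<phi> ^^ e) v" "f v"]
    by (simp add: f g funpow_add add.assoc Nat.funpow_add)
  ultimately show ?thesis unfolding monic_def mem_Collect_eq
    by (intro exI[of _ "\<lambda>v. g ((\<phi> ^^ e) v) + m (f v)"] conjI ext)
qed

lemma low_coeffs:
  "f \<in> low \<phi> d \<Longrightarrow> \<exists>c. (\<forall>i. central (c i)) \<and> f = (\<lambda>v. \<Sum>i<d. c i * (\<phi> ^^ i) v)"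
proof (induction d arbitrary: f)
  case 0 then show ?case by (auto intro: exI[of _ "\<lambda>_. 0"])
next
  case (Suc d)
  then obtain c f' where *: "f = (\<lambda>v. c * v + \<phi> (f' v))" "central c" "f' \<in> low \<phi> d" by auto
  obtain e where e: "\<And>i. central (e i)" "f' = (\<lambda>v. \<Sum>i<d. e i * (\<phi> ^^ i) v)"
    using Suc.IH[OF *(3)] by auto
  have "\<phi> (\<Sum>i<d. e i * (\<phi> ^^ i) v) = (\<Sum>i<d. e i * (\<phi> ^^ Suc i) v)" for v
    by (induction d) (auto simp: zero add scale e)
  then show ?case
    by (intro exI[of _ "case_nat c e"])
       (auto simp: * e sum.lessThan_Suc_shift simp del: sum.lessThan_Suc split: nat.splits)
qed

text \<open>
  Gaussian elimination without division. Subtracting \<open>p i l\<close> times row \<open>l\<close> from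
  \<open>p l l\<close> times row \<open>i\<close> removes \<open>v l\<close>. It keeps the diagonal monic and dominant in degree, because
  a product of two diagonal entries is monic of degree \<open>2 d\<close> while every other product has smaller
  degree. This replaces the determinant in the proof of the Cayley-Hamilton theorem.
\<close>
lemma elimination:
  assumes "finite I" "k \<in> I"
    and "\<And>i. i \<in> I \<Longrightarrow> p i i \<in> monic \<phi> d"
    and "\<And>i j. i \<in> I \<Longrightarrow> j \<in> I \<Longrightarrow> i \<noteq> j \<Longrightarrow> p i j \<in> low \<phi> d"
    and "\<And>i. i \<in> I \<Longrightarrow> (\<Sum>j\<in>I. p i j (v j)) = 0"
  shows "\<exists>m \<in> monic \<phi> (2 ^ (card I - 1) * d). m (v k) = 0"
  using assms
proof (induction "card I" arbitrary: I p d)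
  case 0
  then show ?case by auto
next
  case (Suc r)
  show ?case
  proof (cases "I = {k}")
    case True
    then show ?thesis using Suc.prems(3)[of k] Suc.prems(5)[of k] by auto
  next
    case False
    then obtain l where l: "l \<in> I" "l \<noteq> k" using Suc.prems(2) by auto
    define J where "J = I - {l}"
    have J: "finite J" "k \<in> J" "r = card J" "\<And>i. i \<in> J \<Longrightarrow> i \<in> I" "l \<notin> J"
      using Suc.prems(1,2) Suc.hyps(2) l by (auto simp: J_def)
    define q where "q i j = (\<lambda>u. p l l (p i j u) + - p i l (p l j u))" for i j
    have low: "p i j \<in> low \<phi> (Suc d)" if "i \<in> I" "j \<in> I" for i j
      using Suc.prems(3,4) that monic_low low_Suc by (metis)
    have off: "p i j \<in> low \<phi> d" and diag: "p i i \<in> monic \<phi> d" "p l l \<in> monic \<phi> d"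
      if "i \<in> I" "j \<in> I" "i \<noteq> j" for i j
      using Suc.prems(3,4) l that by auto
    have 1: "q i i \<in> monic \<phi> (2 * d)" if "i \<in> J" for i
    proof -
      have i: "i \<in> I" "i \<noteq> l" using that J by auto
      show ?thesis
        unfolding q_def mult_2 using off[OF i(1) l(1) i(2)] off[OF l(1) i(1)] diag[OF i(1) l(1) i(2)] i
        by (intro monic_add_low[OF monic_comp low_minus[OF low_comp]]) auto
    qed
    have 2: "q i j \<in> low \<phi> (2 * d)" if "i \<in> J" "j \<in> J" "i \<noteq> j" for i j
    proof -
      have i: "i \<in> I" "i \<noteq> l" "j \<in> I" "j \<noteq> l" using that J by auto
      show ?thesis
        unfolding q_def mult_2
        using off[OF i(1) l(1) i(2)] off[OF l(1) i(3)] off[OF i(1,3) that(3)] diag[OF i(1) l(1) i(2)] i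
        by (intro low_add[OF monic_comp_low low_minus[OF low_comp]]) auto
    qed
    have 3: "(\<Sum>j\<in>J. q i j (v j)) = 0" if "i \<in> J" for i
    proof -
      have il: "i \<in> I" using that J by auto
      have "f (\<Sum>j\<in>A. h j) = (\<Sum>j\<in>A. f (h j))" if "f \<in> low \<phi> e" for f e h and A :: "'b set"
        using low_additive[OF that] low_additive[OF that, of 0 0]
        by (induction A rule: infinite_finite_induct) auto
      note s = this
      have a: "(\<Sum>j\<in>J. p i' j (v j)) = - p i' l (v l)" if "i' \<in> I" for i'
        using Suc.prems(5)[OF that] sum.remove[OF Suc.prems(1) l(1), of "\<lambda>j. p i' j (v j)"]
        by (simp add: J_def eq_neg_iff_add_eq_0 add.commute)
      have n: "f (- u) = - f u" if "f \<in> low \<phi> e" for f e u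
        using low_additive[OF that, of u "-u"] low_additive[OF that, of 0 0]
        by (simp add: eq_neg_iff_add_eq_0 add.commute)
      have "(\<Sum>j\<in>J. q i j (v j)) = p l l (\<Sum>j\<in>J. p i j (v j)) - p i l (\<Sum>j\<in>J. p l j (v j))"
        by (simp add: q_def s[OF low[OF l(1) l(1)]] s[OF low[OF il l(1)]] sum_subtractf)
      also have "\<dots> = 0"
        using low_commute[OF low[OF l(1) l(1)] low[OF il l(1)], of "v l"]
        by (simp add: a il l n[OF low[OF l(1) l(1)]] n[OF low[OF il l(1)]])
      finally show ?thesis .
    qed
    have "\<exists>m \<in> monic \<phi> (2 ^ (card J - 1) * (2 * d)). m (v k) = 0"
      using Suc.hyps(1)[OF J(3) J(1,2) 1 2 3] .
    moreover have "2 ^ (card J - 1) * (2 * d) = 2 ^ (card I - 1) * d"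
    proof -
      have "card I - 1 = Suc (card J - 1)" 
      proof -
        have "0 < card J" using J(1,2) by (auto simp: card_gt_0_iff)
        then show ?thesis using J(3) Suc.hyps(2) by linarith
      qed
      then show ?thesis by (simp only: power_Suc mult.assoc mult.left_commute)
    qed
    ultimately show ?thesis by (simp only:)
  qed
qed

text \<open>
  An endomorphism of a finitely generated module over a commutative ring is integral. The degree
  is not optimal; what matters is that it depends on the number of generators only.
\<close>
lemma integral:
  assumes I: "finite I" and z: "\<And>i j. i \<in> I \<Longrightarrow> j \<in> I \<Longrightarrow> central (z i j)"
    and v: "\<And>i. i \<in> I \<Longrightarrow> \<phi> (v i) = (\<Sum>j\<in>I. z i j * v j)"
  shows "\<exists>m \<in> monic \<phi> (card I * 2 ^ (card I - 1)). \<forall>i\<in>I. m (v i) = 0"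
proof -
  define p where "p i j = (if i = j then \<lambda>u. (\<phi> ^^ 1) u + - z i j * u else (\<lambda>u. - z i j * u))" for i j
  have one: "\<exists>m \<in> monic \<phi> (2 ^ (card I - 1) * 1). m (v k) = 0" if "k \<in> I" for k
  proof (rule elimination[OF I that, of p])
    show "p i i \<in> monic \<phi> 1" if "i \<in> I" for i
      using low_const[OF central_minus[OF z[OF that that]]]
      by (force simp: monic_def p_def)
    show "p i j \<in> low \<phi> 1" if "i \<in> I" "j \<in> I" "i \<noteq> j" for i j
      using low_const[OF central_minus[OF z[OF that(1,2)]]] that(3)
      unfolding p_def One_nat_def by (simp only: if_False)
    show "(\<Sum>j\<in>I. p i j (v j)) = 0" if "i \<in> I" for i
    proof -
      have "(\<Sum>j\<in>I. p i j (v j)) = (\<Sum>j\<in>I. (if i = j then \<phi> (v i) else 0) + - (z i j * v j))"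
        by (rule sum.cong) (auto simp: p_def)
      also have "\<dots> = 0" using that I by (simp add: sum_subtractf v)
      finally show ?thesis .
    qed
  qed
  have "\<exists>m \<in> monic \<phi> (card J * 2 ^ (card I - 1)). \<forall>i\<in>J. m (v i) = 0" if "J \<subseteq> I" for J
    using finite_subset[OF that I] that
  proof (induction J rule: finite_induct)
    case empty
    show ?case by (auto simp: monic_def)
  next
    case (insert k J)
    obtain m where m: "m \<in> monic \<phi> (card J * 2 ^ (card I - 1))" "\<And>i. i \<in> J \<Longrightarrow> m (v i) = 0"
      using insert by auto
    obtain m' where m': "m' \<in> monic \<phi> (2 ^ (card I - 1))" "m' (v k) = 0"
      using one insert.prems by auto
    have "(\<lambda>u. m (m' u)) \<in> monic \<phi> (card (insert k J) * 2 ^ (card I - 1))"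
      using monic_comp[OF m(1) m'(1)] insert.hyps by (simp add: algebra_simps)
    moreover have "m (m' (v i)) = 0" if "i \<in> insert k J" for i
    proof (cases "i = k")
      case True then show ?thesis using m' low_additive[OF monic_low[OF m(1)], of 0 0] by simp
    next
      case False
      then have "m (v i) = 0" using m that by auto
      then show ?thesis
        using low_commute[OF monic_low[OF m(1)] monic_low[OF m'(1)]]
          low_additive[OF monic_low[OF m'(1)], of 0 0] by simp
    qed
    ultimately show ?case by (intro bexI[of _ "\<lambda>u. m (m' u)"] ballI)
  qed
  from this[OF order_refl] show ?thesis .
qed

lemma monic_coeffs:
  assumes "m \<in> monic \<phi> d"
  obtains c where "\<And>i. central (c i)" "\<And>v. m v = (\<phi> ^^ d) v + (\<Sum>i<d. c i * (\<phi> ^^ i) v)"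
proof -
  obtain f where f: "f \<in> low \<phi> d" "m = (\<lambda>v. (\<phi> ^^ d) v + f v)" using assms by (auto simp: monic_def)
  then show thesis using low_coeffs[OF f(1)] that by auto
qed

end

lemma operator_conj:
  fixes s s' :: "'a::{ring,monoid_mult}"
  shows "operator (\<lambda>x. s * x * s')"
proof
  show "s * (u + v) * s' = s * u * s' + s * v * s'" for u v by (simp add: algebra_simps)
  show "s * (c * v) * s' = c * (s * v * s')" if "central c" for c v
    using that by (metis central_def mult.assoc)
qed

section \<open>Matrices over a commutative ring\<close>

text \<open>The ring whose multiplicative monoid is \<^const>\<open>Mat_monoid\<close>.\<close>
definition Mat_ring :: "nat \<Rightarrow> ('r, 'b) ring_scheme \<Rightarrow> (nat \<times> nat \<Rightarrow> 'r) ring"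
  where "Mat_ring n R =
    \<lparr>carrier = carrier (Mat_monoid n R), monoid.mult = monoid.mult (Mat_monoid n R),
     one = one (Mat_monoid n R),
     ring.zero = (\<lambda>_ \<in> {..<n} \<times> {..<n}. \<zero>\<^bsub>R\<^esub>),
     add = (\<lambda>A B. \<lambda>p \<in> {..<n} \<times> {..<n}. A p \<oplus>\<^bsub>R\<^esub> B p)\<rparr>"

definition scaled_unit :: "nat \<Rightarrow> ('r, 'b) ring_scheme \<Rightarrow> 'r \<Rightarrow> nat \<times> nat \<Rightarrow> nat \<times> nat \<Rightarrow> 'r"
  where "scaled_unit n R r p = (\<lambda>q \<in> {..<n} \<times> {..<n}. if q = p then r else \<zero>\<^bsub>R\<^esub>)"

definition scalar_mat :: "nat \<Rightarrow> ('r, 'b) ring_scheme \<Rightarrow> 'r \<Rightarrow> nat \<times> nat \<Rightarrow> 'r"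
  where "scalar_mat n R r = (\<lambda>(i, j) \<in> {..<n} \<times> {..<n}. if i = j then r else \<zero>\<^bsub>R\<^esub>)"

context cring
begin

lemma finsum_swap:
  fixes n m :: nat
  assumes "\<And>i j. i < n \<Longrightarrow> j < m \<Longrightarrow> f i j \<in> carrier R"
  shows "(\<Oplus>i\<in>{..<n}. \<Oplus>j\<in>{..<m}. f i j) = (\<Oplus>j\<in>{..<m}. \<Oplus>i\<in>{..<n}. f i j)"
  using assms
proof (induction n)
  case (Suc n)
  have "(\<Oplus>i\<in>{..<Suc n}. \<Oplus>j\<in>{..<m}. f i j) = (\<Oplus>j\<in>{..<m}. f n j) \<oplus> (\<Oplus>i\<in>{..<n}. \<Oplus>j\<in>{..<m}. f i j)"
    unfolding lessThan_Suc by (rule finsum_insert) (use Suc.prems in \<open>auto intro!: finsum_closed\<close>)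
  also have "\<dots> = (\<Oplus>j\<in>{..<m}. f n j) \<oplus> (\<Oplus>j\<in>{..<m}. \<Oplus>i\<in>{..<n}. f i j)"
    using Suc by simp
  also have "\<dots> = (\<Oplus>j\<in>{..<m}. f n j \<oplus> (\<Oplus>i\<in>{..<n}. f i j))"
    by (rule finsum_addf[symmetric]) (use Suc.prems in \<open>auto intro!: finsum_closed\<close>)
  also have "\<dots> = (\<Oplus>j\<in>{..<m}. \<Oplus>i\<in>{..<Suc n}. f i j)"
    unfolding lessThan_Suc
    by (rule finsum_cong', simp)
      (use Suc.prems in \<open>auto intro!: finsum_closed finsum_insert[symmetric]\<close>)
  finally show ?case .
qed auto

lemma mat_entry_closed: "A \<in> carrier (Mat_ring n R) \<Longrightarrow> i < n \<Longrightarrow> j < n \<Longrightarrow> A (i, j) \<in> carrier R"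
  by (auto simp: Mat_ring_def Mat_monoid_def PiE_iff)

lemma mat_entry_closed': "A \<in> carrier (Mat_ring n R) \<Longrightarrow> p \<in> {..<n} \<times> {..<n} \<Longrightarrow> A p \<in> carrier R"
  by (auto simp: Mat_ring_def Mat_monoid_def PiE_iff)

lemma mat_closedI:
  "(\<And>p. p \<in> {..<n} \<times> {..<n} \<Longrightarrow> A p \<in> carrier R) \<Longrightarrow> A \<in> extensional ({..<n} \<times> {..<n}) \<Longrightarrow>
    A \<in> carrier (Mat_ring n R)"
  by (auto simp: Mat_ring_def Mat_monoid_def PiE_iff)

lemma mat_eqI:
  assumes "A \<in> carrier (Mat_ring n R)" "B \<in> carrier (Mat_ring n R)"
    "\<And>i j. i < n \<Longrightarrow> j < n \<Longrightarrow> A (i, j) = B (i, j)"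
  shows "A = B"
  using assms by (intro PiE_ext[of A "{..<n} \<times> {..<n}" "\<lambda>_. carrier R" B])
    (auto simp: Mat_ring_def Mat_monoid_def)

lemma mat_mult_entry:
  "i < n \<Longrightarrow> j < n \<Longrightarrow>
    (A \<otimes>\<^bsub>Mat_ring n R\<^esub> B) (i, j) = (\<Oplus>k\<in>{..<n}. A (i, k) \<otimes> B (k, j))"
  by (simp add: Mat_ring_def Mat_monoid_def)

lemma mat_add_entry:
  "i < n \<Longrightarrow> j < n \<Longrightarrow> (A \<oplus>\<^bsub>Mat_ring n R\<^esub> B) (i, j) = A (i, j) \<oplus> B (i, j)"
  by (simp add: Mat_ring_def)

lemma mat_one_entry:
  "i < n \<Longrightarrow> j < n \<Longrightarrow> \<one>\<^bsub>Mat_ring n R\<^esub> (i, j) = (if i = j then \<one> else \<zero>)"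
  by (simp add: Mat_ring_def Mat_monoid_def)

lemma mat_zero_entry: "i < n \<Longrightarrow> j < n \<Longrightarrow> \<zero>\<^bsub>Mat_ring n R\<^esub> (i, j) = \<zero>"
  by (simp add: Mat_ring_def)

lemmas mat_entries = mat_mult_entry mat_add_entry mat_one_entry mat_zero_entry

lemma mat_mult_closed:
  assumes "A \<in> carrier (Mat_ring n R)" "B \<in> carrier (Mat_ring n R)"
  shows "A \<otimes>\<^bsub>Mat_ring n R\<^esub> B \<in> carrier (Mat_ring n R)"
proof (rule mat_closedI)
  fix p assume "p \<in> {..<n} \<times> {..<n}"
  then show "(A \<otimes>\<^bsub>Mat_ring n R\<^esub> B) p \<in> carrier R"
    by (auto simp: mat_entries intro!: finsum_closed m_closed mat_entry_closed[OF assms(1)]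
        mat_entry_closed[OF assms(2)])
qed (simp add: Mat_ring_def Mat_monoid_def)

lemma mat_add_closed:
  assumes "A \<in> carrier (Mat_ring n R)" "B \<in> carrier (Mat_ring n R)"
  shows "A \<oplus>\<^bsub>Mat_ring n R\<^esub> B \<in> carrier (Mat_ring n R)"
proof (rule mat_closedI)
  fix p assume "p \<in> {..<n} \<times> {..<n}"
  then show "(A \<oplus>\<^bsub>Mat_ring n R\<^esub> B) p \<in> carrier R"
    by (auto simp: mat_entries intro!: a_closed mat_entry_closed[OF assms(1)]
        mat_entry_closed[OF assms(2)])
qed (simp add: Mat_ring_def)

lemma mat_one_closed: "\<one>\<^bsub>Mat_ring n R\<^esub> \<in> carrier (Mat_ring n R)"
  by (rule mat_closedI) (auto simp: mat_entries, simp add: Mat_ring_def Mat_monoid_def)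

lemma mat_zero_closed: "\<zero>\<^bsub>Mat_ring n R\<^esub> \<in> carrier (Mat_ring n R)"
  by (rule mat_closedI) (auto simp: mat_entries, simp add: Mat_ring_def)

lemma mat_mult_assoc:
  assumes A: "A \<in> carrier (Mat_ring n R)" and B: "B \<in> carrier (Mat_ring n R)"
    and C: "C \<in> carrier (Mat_ring n R)"
  shows "(A \<otimes>\<^bsub>Mat_ring n R\<^esub> B) \<otimes>\<^bsub>Mat_ring n R\<^esub> C
       = A \<otimes>\<^bsub>Mat_ring n R\<^esub> (B \<otimes>\<^bsub>Mat_ring n R\<^esub> C)"
proof (rule mat_eqI[where n = n])
  fix i j assume ij: "i < n" "j < n"
  note [simp] = mat_entry_closed[OF A] mat_entry_closed[OF B] mat_entry_closed[OF C] ij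
  have "((A \<otimes>\<^bsub>Mat_ring n R\<^esub> B) \<otimes>\<^bsub>Mat_ring n R\<^esub> C) (i, j)
      = (\<Oplus>k\<in>{..<n}. (\<Oplus>l\<in>{..<n}. A (i, l) \<otimes> B (l, k)) \<otimes> C (k, j))"
    by (simp add: mat_mult_entry) (rule finsum_cong', auto simp: mat_mult_entry intro!: finsum_closed)
  also have "\<dots> = (\<Oplus>k\<in>{..<n}. \<Oplus>l\<in>{..<n}. A (i, l) \<otimes> B (l, k) \<otimes> C (k, j))"
    by (rule finsum_cong', simp) (auto intro!: finsum_closed finsum_ldistr)
  also have "\<dots> = (\<Oplus>l\<in>{..<n}. \<Oplus>k\<in>{..<n}. A (i, l) \<otimes> B (l, k) \<otimes> C (k, j))"
    by (rule finsum_swap) simp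
  also have "\<dots> = (\<Oplus>l\<in>{..<n}. \<Oplus>k\<in>{..<n}. A (i, l) \<otimes> (B (l, k) \<otimes> C (k, j)))"
    by (intro finsum_cong') (auto intro!: finsum_closed m_assoc finsum_cong')
  also have "\<dots> = (\<Oplus>l\<in>{..<n}. A (i, l) \<otimes> (\<Oplus>k\<in>{..<n}. B (l, k) \<otimes> C (k, j)))"
    by (rule finsum_cong', simp) (auto intro!: finsum_closed finsum_rdistr[symmetric])
  also have "\<dots> = (A \<otimes>\<^bsub>Mat_ring n R\<^esub> (B \<otimes>\<^bsub>Mat_ring n R\<^esub> C)) (i, j)"
    by (simp add: mat_mult_entry) (rule finsum_cong', auto simp: mat_mult_entry intro!: finsum_closed)
  finally show "((A \<otimes>\<^bsub>Mat_ring n R\<^esub> B) \<otimes>\<^bsub>Mat_ring n R\<^esub> C) (i, j)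
      = (A \<otimes>\<^bsub>Mat_ring n R\<^esub> (B \<otimes>\<^bsub>Mat_ring n R\<^esub> C)) (i, j)" .
qed (use assms mat_mult_closed in auto)

lemma scalar_mult_entry:
  assumes "A \<in> carrier (Mat_ring n R)" "r \<in> carrier R" "i < n" "j < n"
  shows "(scalar_mat n R r \<otimes>\<^bsub>Mat_ring n R\<^esub> A) (i, j) = r \<otimes> A (i, j)"
    and "(A \<otimes>\<^bsub>Mat_ring n R\<^esub> scalar_mat n R r) (i, j) = A (i, j) \<otimes> r"
proof -
  note [simp] = mat_entry_closed[OF assms(1)] assms
  have "(scalar_mat n R r \<otimes>\<^bsub>Mat_ring n R\<^esub> A) (i, j)
      = (\<Oplus>k\<in>{..<n}. if i = k then r \<otimes> A (k, j) else \<zero>)"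
    by (simp add: mat_entries) (rule finsum_cong', auto simp: scalar_mat_def)
  then show "(scalar_mat n R r \<otimes>\<^bsub>Mat_ring n R\<^esub> A) (i, j) = r \<otimes> A (i, j)"
    by (simp add: finsum_singleton)
  have "(A \<otimes>\<^bsub>Mat_ring n R\<^esub> scalar_mat n R r) (i, j)
      = (\<Oplus>k\<in>{..<n}. if j = k then A (i, k) \<otimes> r else \<zero>)"
    by (simp add: mat_entries) (rule finsum_cong', auto simp: scalar_mat_def)
  then show "(A \<otimes>\<^bsub>Mat_ring n R\<^esub> scalar_mat n R r) (i, j) = A (i, j) \<otimes> r"
    by (simp add: finsum_singleton)
qed

lemma mat_one_eq_scalar: "\<one>\<^bsub>Mat_ring n R\<^esub> = scalar_mat n R \<one>"
  by (simp add: Mat_ring_def Mat_monoid_def scalar_mat_def)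

lemma mat_ring: "ring (Mat_ring n R)"
proof (rule ringI)
  show "abelian_group (Mat_ring n R)"
  proof (rule abelian_groupI)
    fix A assume A: "A \<in> carrier (Mat_ring n R)"
    show "\<exists>B\<in>carrier (Mat_ring n R). B \<oplus>\<^bsub>Mat_ring n R\<^esub> A = \<zero>\<^bsub>Mat_ring n R\<^esub>"
    proof (rule bexI)
      show cl: "(\<lambda>p \<in> {..<n} \<times> {..<n}. \<ominus> A p) \<in> carrier (Mat_ring n R)"
        using mat_entry_closed'[OF A] by (intro mat_closedI) auto
      show "(\<lambda>p \<in> {..<n} \<times> {..<n}. \<ominus> A p) \<oplus>\<^bsub>Mat_ring n R\<^esub> A = \<zero>\<^bsub>Mat_ring n R\<^esub>"
        using mat_entry_closed[OF A]
        by (intro mat_eqI[where n = n] mat_add_closed cl A mat_zero_closed) (simp add: mat_entries l_neg)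
    qed
  qed (auto intro!: mat_eqI[where n = n] mat_add_closed mat_zero_closed
      simp: mat_entries mat_entry_closed a_ac)
  show "Group.monoid (Mat_ring n R)"
    by (rule monoidI)
      (auto simp: mat_mult_closed mat_one_closed mat_mult_assoc mat_entry_closed
        mat_one_eq_scalar[symmetric] scalar_mult_entry[where r = \<one>, folded mat_one_eq_scalar]
        intro!: mat_eqI[where n = n])
next
  fix A B C
  assume A: "A \<in> carrier (Mat_ring n R)" and B: "B \<in> carrier (Mat_ring n R)"
    and C: "C \<in> carrier (Mat_ring n R)"
  note cl = mat_entry_closed[OF A] mat_entry_closed[OF B] mat_entry_closed[OF C]
  show "(A \<oplus>\<^bsub>Mat_ring n R\<^esub> B) \<otimes>\<^bsub>Mat_ring n R\<^esub> C =
    A \<otimes>\<^bsub>Mat_ring n R\<^esub> C \<oplus>\<^bsub>Mat_ring n R\<^esub> B \<otimes>\<^bsub>Mat_ring n R\<^esub> C"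
  proof (rule mat_eqI[where n = n])
    fix i j assume ij: "i < n" "j < n"
    have "(\<Oplus>k\<in>{..<n}. (A (i, k) \<oplus> B (i, k)) \<otimes> C (k, j))
        = (\<Oplus>k\<in>{..<n}. A (i, k) \<otimes> C (k, j) \<oplus> B (i, k) \<otimes> C (k, j))"
      by (rule finsum_cong', simp) (use cl ij in \<open>auto simp: l_distr\<close>)
    also have "\<dots> = (\<Oplus>k\<in>{..<n}. A (i, k) \<otimes> C (k, j)) \<oplus> (\<Oplus>k\<in>{..<n}. B (i, k) \<otimes> C (k, j))"
      by (rule finsum_addf) (use cl ij in auto)
    moreover have "(\<Oplus>k\<in>{..<n}. (A \<oplus>\<^bsub>Mat_ring n R\<^esub> B) (i, k) \<otimes> C (k, j))
        = (\<Oplus>k\<in>{..<n}. (A (i, k) \<oplus> B (i, k)) \<otimes> C (k, j))"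
      by (rule finsum_cong', simp) (use cl ij in \<open>auto simp: mat_add_entry\<close>)
    ultimately show "((A \<oplus>\<^bsub>Mat_ring n R\<^esub> B) \<otimes>\<^bsub>Mat_ring n R\<^esub> C) (i, j) =
      (A \<otimes>\<^bsub>Mat_ring n R\<^esub> C \<oplus>\<^bsub>Mat_ring n R\<^esub> B \<otimes>\<^bsub>Mat_ring n R\<^esub> C) (i, j)"
      using ij by (simp add: mat_mult_entry mat_add_entry)
  qed (intro mat_add_closed mat_mult_closed A B C)+
  show "C \<otimes>\<^bsub>Mat_ring n R\<^esub> (A \<oplus>\<^bsub>Mat_ring n R\<^esub> B) =
    C \<otimes>\<^bsub>Mat_ring n R\<^esub> A \<oplus>\<^bsub>Mat_ring n R\<^esub> C \<otimes>\<^bsub>Mat_ring n R\<^esub> B"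
  proof (rule mat_eqI[where n = n])
    fix i j assume ij: "i < n" "j < n"
    have "(\<Oplus>k\<in>{..<n}. C (i, k) \<otimes> (A (k, j) \<oplus> B (k, j)))
        = (\<Oplus>k\<in>{..<n}. C (i, k) \<otimes> A (k, j) \<oplus> C (i, k) \<otimes> B (k, j))"
      by (rule finsum_cong', simp) (use cl ij in \<open>auto simp: r_distr\<close>)
    also have "\<dots> = (\<Oplus>k\<in>{..<n}. C (i, k) \<otimes> A (k, j)) \<oplus> (\<Oplus>k\<in>{..<n}. C (i, k) \<otimes> B (k, j))"
      by (rule finsum_addf) (use cl ij in auto)
    moreover have "(\<Oplus>k\<in>{..<n}. C (i, k) \<otimes> (A \<oplus>\<^bsub>Mat_ring n R\<^esub> B) (k, j))
        = (\<Oplus>k\<in>{..<n}. C (i, k) \<otimes> (A (k, j) \<oplus> B (k, j)))"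
      by (rule finsum_cong', simp) (use cl ij in \<open>auto simp: mat_add_entry\<close>)
    ultimately show "(C \<otimes>\<^bsub>Mat_ring n R\<^esub> (A \<oplus>\<^bsub>Mat_ring n R\<^esub> B)) (i, j) =
      (C \<otimes>\<^bsub>Mat_ring n R\<^esub> A \<oplus>\<^bsub>Mat_ring n R\<^esub> C \<otimes>\<^bsub>Mat_ring n R\<^esub> B) (i, j)"
      using ij by (simp add: mat_mult_entry mat_add_entry)
  qed (intro mat_add_closed mat_mult_closed A B C)+
qed

lemma scalar_mat_closed: "r \<in> carrier R \<Longrightarrow> scalar_mat n R r \<in> carrier (Mat_ring n R)"
  by (rule mat_closedI) (auto simp: scalar_mat_def)

lemma scaled_unit_closed: "r \<in> carrier R \<Longrightarrow> scaled_unit n R r p \<in> carrier (Mat_ring n R)"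
  by (rule mat_closedI) (auto simp: scaled_unit_def)

lemma scaled_unit_eq:
  assumes "r \<in> carrier R"
  shows "scaled_unit n R r p = scalar_mat n R r \<otimes>\<^bsub>Mat_ring n R\<^esub> scaled_unit n R \<one> p"
  by (rule mat_eqI[where n = n])
    (use assms in \<open>auto simp: scalar_mult_entry scaled_unit_closed scalar_mat_closed mat_mult_closed\<close>,
     auto simp: scaled_unit_def)

lemma scalar_mat_commute:
  assumes "A \<in> carrier (Mat_ring n R)" "r \<in> carrier R"
  shows "scalar_mat n R r \<otimes>\<^bsub>Mat_ring n R\<^esub> A = A \<otimes>\<^bsub>Mat_ring n R\<^esub> scalar_mat n R r"
  by (rule mat_eqI[where n = n])
    (use assms in \<open>auto simp: scalar_mult_entry scalar_mat_closed mat_mult_closed mat_entry_closed m_comm\<close>)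

lemma mat_finsum_entry:
  assumes "finite I" "\<And>p. p \<in> I \<Longrightarrow> F p \<in> carrier (Mat_ring n R)" "i < n" "j < n"
  shows "finsum (Mat_ring n R) F I (i, j) = (\<Oplus>p\<in>I. F p (i, j))"
  using assms(1,2)
proof (induction I rule: finite_induct)
  case empty
  interpret M: ring "Mat_ring n R" by (rule mat_ring)
  show ?case using assms by (simp add: mat_entries)
next
  case (insert p I)
  interpret M: ring "Mat_ring n R" by (rule mat_ring)
  have "finsum (Mat_ring n R) F (insert p I) = F p \<oplus>\<^bsub>Mat_ring n R\<^esub> finsum (Mat_ring n R) F I"
    by (rule M.finsum_insert) (use insert in auto)
  moreover have "(\<Oplus>p\<in>insert p I. F p (i, j)) = F p (i, j) \<oplus> (\<Oplus>p\<in>I. F p (i, j))"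
    by (rule finsum_insert) (use insert assms in \<open>auto intro!: mat_entry_closed\<close>)
  ultimately show ?case using insert assms by (simp add: mat_entries)
qed

lemma mat_expansion:
  assumes "A \<in> carrier (Mat_ring n R)"
  shows "A = finsum (Mat_ring n R)
    (\<lambda>p. scalar_mat n R (A p) \<otimes>\<^bsub>Mat_ring n R\<^esub> scaled_unit n R \<one> p) ({..<n} \<times> {..<n})"
proof -
  interpret M: ring "Mat_ring n R" by (rule mat_ring)
  have "A = finsum (Mat_ring n R) (\<lambda>p. scaled_unit n R (A p) p) ({..<n} \<times> {..<n})" (is "_ = ?B")
  proof (rule mat_eqI[where n = n])
    show "?B \<in> carrier (Mat_ring n R)"
      using mat_entry_closed'[OF assms] by (intro M.finsum_closed) (auto intro!: scaled_unit_closed)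
    fix i j assume ij: "i < n" "j < n"
    then have "?B (i, j) = (\<Oplus>p\<in>{..<n} \<times> {..<n}. scaled_unit n R (A p) p (i, j))"
      using mat_entry_closed'[OF assms] by (intro mat_finsum_entry) (auto intro!: scaled_unit_closed)
    also have "\<dots> = (\<Oplus>p\<in>{..<n} \<times> {..<n}. if (i, j) = p then A p else \<zero>)"
      using mat_entry_closed'[OF assms] ij by (intro finsum_cong') (auto simp: scaled_unit_def)
    also have "\<dots> = A (i, j)"
      using mat_entry_closed'[OF assms] ij by (intro finsum_singleton) auto
    finally show "A (i, j) = ?B (i, j)" by simp
  qed fact
  also have "\<dots> = finsum (Mat_ring n R)
    (\<lambda>p. scalar_mat n R (A p) \<otimes>\<^bsub>Mat_ring n R\<^esub> scaled_unit n R \<one> p) ({..<n} \<times> {..<n})"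
    using mat_entry_closed'[OF assms]
    by (intro M.finsum_cong')
      (auto intro!: scaled_unit_eq mat_mult_closed scalar_mat_closed scaled_unit_closed)
  finally show ?thesis .
qed

end

text \<open>
  What remains of an embedding into \<open>GL(n,R)\<close> for the rest of the proof: a faithful
  multiplicative map for which conjugation by any element satisfies, on the image, a monic relation
  of a fixed degree.
\<close>
definition linear_rep ::
    "('g, 'b) monoid_scheme \<Rightarrow> ('g \<Rightarrow> 'a::{ring,monoid_mult}) \<Rightarrow> nat \<Rightarrow> bool"
  where "linear_rep G \<pi> D \<longleftrightarrow>
    (\<forall>x\<in>carrier G. \<forall>y\<in>carrier G. \<pi> (x \<otimes>\<^bsub>G\<^esub> y) = \<pi> x * \<pi> y) \<and> \<pi> \<one>\<^bsub>G\<^esub> = 1 \<and> inj_on \<pi> (carrier G) \<and>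
    (\<forall>s\<in>carrier G. \<forall>s'\<in>carrier G. s \<otimes>\<^bsub>G\<^esub> s' = \<one>\<^bsub>G\<^esub> \<longrightarrow>
      (\<exists>m \<in> monic (\<lambda>Y. \<pi> s * Y * \<pi> s') D. \<forall>x\<in>carrier G. m (\<pi> x) = 0))"

text \<open>
  The matrix units generate the matrix ring over the scalar matrices, so conjugation is integral on
  the factor in question. On the other factors the image is made trivial by adding
  \<open>1 - e\<close>, where \<open>e\<close> is the idempotent of the factor. This adds the root \<open>1\<close> to the monic relation,
  which accounts for the additional degree.
\<close>
lemma linear_rep_of_matrices:
  fixes G :: "('g, 'c) monoid_scheme" and R :: "('r, 'b) ring_scheme"
  assumes R: "cring R" and one: "\<one>\<^bsub>G\<^esub> \<in> carrier G" "\<one>\<^bsub>G\<^esub> \<otimes>\<^bsub>G\<^esub> \<one>\<^bsub>G\<^esub> = \<one>\<^bsub>G\<^esub>"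
    and \<rho>: "\<rho> \<in> mon G (GL n R)"
  obtains \<pi> :: "'g \<Rightarrow> (nat \<times> nat \<Rightarrow> 'r) all_rings" and D where "linear_rep G \<pi> D"
proof -
  interpret R: cring R by fact
  define S where "S = Mat_ring n R"
  interpret S: ring S unfolding S_def by (rule R.mat_ring)
  note S = S.ring_axioms
  note cl = R.mat_ring
  have GL: "carrier (GL n R) = Units S" "monoid.mult (GL n R) = monoid.mult S"
    by (auto simp: GL_def units_of_def S_def Mat_ring_def Units_def)
  have \<rho>_in: "\<rho> x \<in> Units S" if "x \<in> carrier G" for x
    using \<rho> that by (auto simp: mon_def hom_def GL)
  then have \<rho>_cl [simp]: "\<rho> x \<in> carrier S" if "x \<in> carrier G" for x
    using that by (auto simp: Units_def)
  have \<rho>_mult: "\<rho> (x \<otimes>\<^bsub>G\<^esub> y) = \<rho> x \<otimes>\<^bsub>S\<^esub> \<rho> y" if "x \<in> carrier G" "y \<in> carrier G" for x y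
    using \<rho> that by (auto simp: mon_def hom_def GL)
  have \<rho>_one: "\<rho> \<one>\<^bsub>G\<^esub> = \<one>\<^bsub>S\<^esub>"
    using \<rho>_mult[OF one(1) one(1)] \<rho>_in[OF one(1)] one
    by (metis S.Units_closed S.Units_l_cancel S.one_closed S.r_one)
  define e where "e = at_ring S (one S)"
  have e: "e * x = x * e" for x unfolding e_def by (rule at_ring_one_central[OF S])
  have at_e: "at_ring S x * e = at_ring S x" if "x \<in> carrier S" for x
    using at_ring_simps(2)[OF S that S.one_closed] that by (simp add: e_def)
  have ee: "e * e = e" unfolding e_def using at_e[of "one S"] by (simp add: e_def)
  define \<pi> where "\<pi> g = at_ring S (\<rho> g) + (1 - e)" for g
  have at_ne: "at_ring S x * (1 - e) = 0" if "x \<in> carrier S" for x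
    using at_e[OF that] by (simp add: algebra_simps)
  have ne_at: "(1 - e) * at_ring S x = 0" if "x \<in> carrier S" for x
    using at_e[OF that] e[of "at_ring S x"] by (simp add: algebra_simps)
  have ne: "(1 - e) * (1 - e) = 1 - e" by (simp add: algebra_simps ee)
  have \<pi>_mult: "\<pi> (x \<otimes>\<^bsub>G\<^esub> y) = \<pi> x * \<pi> y" if "x \<in> carrier G" "y \<in> carrier G" for x y
    unfolding \<pi>_def \<rho>_mult[OF that]
    using that by (simp add: at_ring_simps[OF S] distrib_left distrib_right at_ne ne_at ne del: right_diff_distrib)
  have \<pi>_one: "\<pi> \<one>\<^bsub>G\<^esub> = 1"
    by (simp add: \<pi>_def \<rho>_one e_def)
  have "inj_on \<pi> (carrier G)"
  proof (rule inj_onI)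
    fix x y assume xy: "x \<in> carrier G" "y \<in> carrier G" "\<pi> x = \<pi> y"
    then have "coord S (at_ring S (\<rho> x)) = coord S (at_ring S (\<rho> y))" by (simp add: \<pi>_def)
    then have "\<rho> x = \<rho> y" using xy by (simp add: coord_at_ring[OF S])
    then show "x = y" using \<rho> xy by (auto simp: mon_def inj_on_def)
  qed
  moreover
  define I where "I = {..<n} \<times> {..<n}"
  have "\<exists>m \<in> monic (\<lambda>Y. \<pi> s * Y * \<pi> s') (Suc (card I * 2 ^ (card I - 1))). \<forall>x\<in>carrier G. m (\<pi> x) = 0"
    if s: "s \<in> carrier G" "s' \<in> carrier G" "s \<otimes>\<^bsub>G\<^esub> s' = \<one>\<^bsub>G\<^esub>" for s s'
  proof -
    define \<phi> where "\<phi> = (\<lambda>Y. \<pi> s * Y * \<pi> s')"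
    interpret operator \<phi> unfolding \<phi>_def by (rule operator_conj)
    define E where "E p = scaled_unit n R \<one>\<^bsub>R\<^esub> p" for p
    have E: "E p \<in> carrier S" for p unfolding E_def S_def by (rule R.scaled_unit_closed) simp
    define sc where "sc r = at_ring S (scalar_mat n R r)" for r
    have sc_central: "central (sc r)" if "r \<in> carrier R" for r
      unfolding central_def
    proof (intro allI all_rings_eqI)
      fix Y :: "(nat \<times> nat \<Rightarrow> 'r) all_rings" and S' :: "(nat \<times> nat \<Rightarrow> 'r) ring"
      assume S': "ring S'"
      interpret S': ring S' by fact
      show "coord S' (sc r * Y) = coord S' (Y * sc r)"
        using R.scalar_mat_commute[OF coord_closed[OF S, of Y, unfolded S_def] that]
        by (simp add: sc_def coord_simps[OF S'] coord_at_ring[OF S'] coord_closed[OF S'])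
          (simp add: S_def)
    qed
    have expand: "at_ring S A = (\<Sum>p\<in>I. sc (A p) * at_ring S (E p))" if A: "A \<in> carrier S" for A
    proof -
      have 1: "scalar_mat n R (A p) \<in> carrier S" if "p \<in> I" for p
        using R.mat_entry_closed'[OF A[unfolded S_def]] that
        by (auto simp: I_def S_def intro!: R.scalar_mat_closed)
      have "at_ring S A = at_ring S (finsum S (\<lambda>p. scalar_mat n R (A p) \<otimes>\<^bsub>S\<^esub> E p) I)"
        using R.mat_expansion[OF A[unfolded S_def]] by (simp add: S_def E_def I_def)
      also have "\<dots> = (\<Sum>p\<in>I. at_ring S (scalar_mat n R (A p) \<otimes>\<^bsub>S\<^esub> E p))"
        by (rule at_ring_finsum[OF S]) (use 1 E in \<open>auto simp: I_def\<close>)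
      also have "\<dots> = (\<Sum>p\<in>I. sc (A p) * at_ring S (E p))"
        by (rule sum.cong) (use 1 E in \<open>auto simp: at_ring_simps[OF S] sc_def\<close>)
      finally show ?thesis .
    qed
    have conj_at: "\<phi> (at_ring S A) = at_ring S (\<rho> s \<otimes>\<^bsub>S\<^esub> A \<otimes>\<^bsub>S\<^esub> \<rho> s')" if "A \<in> carrier S" for A
      using s that
      by (simp add: \<phi>_def \<pi>_def at_ring_simps[OF S] distrib_left distrib_right at_ne ne_at mult.assoc
          del: right_diff_distrib)
        (simp add: at_ne ne_at mult.assoc[symmetric])
    have "\<exists>m \<in> monic \<phi> (card I * 2 ^ (card I - 1)). \<forall>p\<in>I. m (at_ring S (E p)) = 0"
    proof (rule integral)
      show "finite I" by (simp add: I_def)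
      let ?A = "\<lambda>p. \<rho> s \<otimes>\<^bsub>S\<^esub> E p \<otimes>\<^bsub>S\<^esub> \<rho> s'"
      have A: "?A p \<in> carrier S" for p using s E by simp
      show "\<phi> (at_ring S (E p)) = (\<Sum>q\<in>I. sc (?A p q) * at_ring S (E q))" for p
        unfolding conj_at[OF E] by (rule expand[OF A])
      show "central (sc (?A p q))" if "q \<in> I" for p q
        using R.mat_entry_closed'[OF A[of p, unfolded S_def]] that
        by (intro sc_central) (auto simp: S_def I_def)
    qed
    then obtain m where m: "m \<in> monic \<phi> (card I * 2 ^ (card I - 1))" "\<And>p. p \<in> I \<Longrightarrow> m (at_ring S (E p)) = 0"
      by auto
    note ml = monic_low[OF m(1)]
    have m_at: "m (at_ring S A) = 0" if A: "A \<in> carrier S" for A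
    proof -
      have 1: "m (\<Sum>p\<in>J. sc (A p) * at_ring S (E p)) = 0" if "finite J" "J \<subseteq> I" for J
        using that
      proof (induction J rule: finite_induct)
        case empty
        show ?case using low_additive[OF ml, of 0 0] by simp
      next
        case (insert p J)
        have "m (sc (A p) * at_ring S (E p)) = sc (A p) * m (at_ring S (E p))"
          using R.mat_entry_closed'[OF A[unfolded S_def]] insert
          by (intro low_central[OF ml] sc_central) (auto simp: I_def)
        then show ?case using insert m(2) by (simp add: low_additive[OF ml])
      qed
      show ?thesis unfolding expand[OF A] by (rule 1) (auto simp: I_def)
    qed
    \<comment> \<open>Conjugation fixes \<open>1 - e\<close>, so one more factor \<open>\<phi> - 1\<close> kills this summand of \<open>\<pi> x\<close>, too.\<close>
    have \<phi>ne: "\<phi> (1 - e) = 1 - e"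
      unfolding \<phi>_def \<pi>_def using s
      by (simp add: distrib_left distrib_right at_ne ne_at ne mult.assoc del: right_diff_distrib left_diff_distrib)
    have mne: "\<phi> (m (1 - e)) = m (1 - e)"
      using low_commute_\<phi>[OF ml, of "1 - e"] by (simp add: \<phi>ne)
    define m' where "m' = (\<lambda>v. \<phi> (m v) + - m v)"
    have "(\<lambda>v. \<phi> v + - v) \<in> monic \<phi> 1"
      using low_const[OF central_minus[OF central_1]] by (force simp: monic_def)
    from monic_comp[OF this m(1)] have "m' \<in> monic \<phi> (Suc (card I * 2 ^ (card I - 1)))"
      by (simp add: m'_def)
    moreover have "m' (\<pi> x) = 0" if "x \<in> carrier G" for x
      using that by (simp add: m'_def \<pi>_def low_additive[OF ml] m_at mne)
    ultimately show ?thesis unfolding \<phi>_def by blast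
  qed
  ultimately have "linear_rep G \<pi> (Suc (card I * 2 ^ (card I - 1)))"
    unfolding linear_rep_def using \<pi>_mult \<pi>_one by blast
  then show thesis by (rule that)
qed

section \<open>Unipotence from the independence of characters\<close>

text \<open>
  Dedekind's proof that distinct characters are linearly independent, in a ring in which
  differences of character values cannot be cancelled. Comparing the relation at \<open>x + y\<close>
  with \<open>\<chi> k y\<close> times the relation at \<open>x\<close> eliminates \<open>\<chi> k\<close>; the factors picked up by the
  coefficient of \<open>\<psi>\<close> remain in the conclusion.
\<close>
lemma character_elimination:
  fixes \<chi> :: "nat \<Rightarrow> 'g::ab_group_add \<Rightarrow> 'a::{ring,monoid_mult}" and \<psi> :: "'g \<Rightarrow> 'a"
  assumes \<chi>: "\<And>i x y. \<chi> i (x + y) = \<chi> i x * \<chi> i y" and \<psi>: "\<psi> 0 = 1" "\<And>x y. \<psi> (x + y) = \<psi> x * \<psi> y"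
    and comm: "\<And>i j x y. \<chi> i x * \<chi> j y = \<chi> j y * \<chi> i x" "\<And>i x y. \<chi> i x * \<psi> y = \<psi> y * \<chi> i x"
    and rel: "\<And>x. (\<Sum>i<k. \<chi> i x * C i) + \<psi> x * E = 0"
  shows "prod_list (map (\<lambda>i. \<psi> (b i) - \<chi> i (b i)) [0..<k]) * E = 0"
  using rel
proof (induction k arbitrary: C E)
  case 0
  show ?case using 0[of 0] by (simp add: \<psi>(1))
next
  case (Suc k)
  let ?y = "b k"
  have "(\<Sum>i<k. \<chi> i x * ((\<chi> i ?y - \<chi> k ?y) * C i)) + \<psi> x * ((\<psi> ?y - \<chi> k ?y) * E) = 0" for x
  proof -
    have "(\<Sum>i<k. \<chi> i x * ((\<chi> i ?y - \<chi> k ?y) * C i)) = (\<Sum>i<Suc k. \<chi> i x * ((\<chi> i ?y - \<chi> k ?y) * C i))"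
      by simp
    also have "\<dots> = (\<Sum>i<Suc k. \<chi> i (x + ?y) * C i - \<chi> k ?y * (\<chi> i x * C i))"
      by (rule sum.cong) (simp_all add: \<chi> algebra_simps, metis comm(1) mult.assoc)
    finally have "(\<Sum>i<k. \<chi> i x * ((\<chi> i ?y - \<chi> k ?y) * C i)) =
        (\<Sum>i<Suc k. \<chi> i (x + ?y) * C i) - \<chi> k ?y * (\<Sum>i<Suc k. \<chi> i x * C i)"
      by (simp only: sum_subtractf sum_distrib_left)
    moreover have "\<psi> x * ((\<psi> ?y - \<chi> k ?y) * E) = \<psi> (x + ?y) * E - \<chi> k ?y * (\<psi> x * E)"
      by (simp add: \<psi> algebra_simps) (metis comm(2) mult.assoc)
    ultimately have "(\<Sum>i<k. \<chi> i x * ((\<chi> i ?y - \<chi> k ?y) * C i)) + \<psi> x * ((\<psi> ?y - \<chi> k ?y) * E)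
      = ((\<Sum>i<Suc k. \<chi> i (x + ?y) * C i) + \<psi> (x + ?y) * E)
        - \<chi> k ?y * ((\<Sum>i<Suc k. \<chi> i x * C i) + \<psi> x * E)"
      by (simp only: distrib_left) (simp only: algebra_simps)
    also have "\<dots> = 0" unfolding Suc.prems by simp
    finally show ?thesis .
  qed
  from Suc.IH[OF this] show ?case by (simp add: mult.assoc)
qed

text \<open>
  An additive group \<open>'g\<close>, represented by commuting units, that is normalized by a unit \<open>s\<close> with
  inverse \<open>s'\<close>; conjugation by \<open>s\<close> corresponds to the automorphism \<open>S\<close> of \<open>'g\<close>.
\<close>
locale normalized_rep =
  fixes \<pi> :: "'g::ab_group_add \<Rightarrow> 'a::{ring,monoid_mult}" and s s' :: 'a and S S' :: "'g \<Rightarrow> 'g"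
  assumes \<pi>_add: "\<pi> (x + y) = \<pi> x * \<pi> y" and \<pi>_0: "\<pi> 0 = 1"
    and s: "s * s' = 1" "s' * s = 1"
    and S_add: "S (x + y) = S x + S y" and SS': "S (S' x) = x" "S' (S x) = x"
    and intertwine: "s * \<pi> x = \<pi> (S x) * s"
begin

lemma \<pi>_commute: "\<pi> x * \<pi> y = \<pi> y * \<pi> x"
  by (metis \<pi>_add add.commute)

lemma conj: "s * \<pi> x * s' = \<pi> (S x)" "s' * \<pi> x * s = \<pi> (S' x)"
proof -
  show "s * \<pi> x * s' = \<pi> (S x)" by (simp add: intertwine mult.assoc s)
  have "s' * \<pi> x * s = s' * (\<pi> (S (S' x)) * s)" by (simp add: SS' mult.assoc)
  also have "\<dots> = \<pi> (S' x)" by (metis intertwine mult.assoc mult_1 s(2))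
  finally show "s' * \<pi> x * s = \<pi> (S' x)" .
qed

lemma S_pow_add: "(S ^^ i) (x + y) = (S ^^ i) x + (S ^^ i) y"
  by (induction i) (auto simp: S_add)

lemma S_pow_0: "(S ^^ i) 0 = 0"
  using S_pow_add[of i 0 0] by simp

lemma conj_pow: "((\<lambda>x. s * x * s') ^^ i) (\<pi> x) = \<pi> ((S ^^ i) x)"
  by (induction i) (auto simp: conj)

lemma prod_pull: 
  "prod_list (map (\<lambda>i. (\<pi> (h i) - 1) * \<pi> (w i)) xs) =
    prod_list (map (\<lambda>i. \<pi> (h i) - 1) xs) * \<pi> (sum_list (map w xs))"
proof (induction xs)
  case (Cons i xs)
  let ?p = "prod_list (map (\<lambda>i. \<pi> (h i) - 1) xs)"
  have c: "\<pi> y * prod_list (map (\<lambda>i. \<pi> (h i) - 1) ys) = prod_list (map (\<lambda>i. \<pi> (h i) - 1) ys) * \<pi> y" for y ys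
  proof (induction ys)
    case (Cons j ys)
    let ?q = "prod_list (map (\<lambda>i. \<pi> (h i) - 1) ys)"
    have "\<pi> y * (\<pi> (h j) - 1) = (\<pi> (h j) - 1) * \<pi> y"
      by (simp add: algebra_simps \<pi>_commute)
    then have "\<pi> y * ((\<pi> (h j) - 1) * ?q) = (\<pi> (h j) - 1) * (\<pi> y * ?q)"
      by (simp only: mult.assoc[symmetric])
    also have "\<dots> = (\<pi> (h j) - 1) * ?q * \<pi> y" by (simp only: Cons mult.assoc)
    finally show ?case by simp
  qed simp
  have "(\<pi> (h i) - 1) * \<pi> (w i) * (?p * \<pi> (sum_list (map w xs)))
      = (\<pi> (h i) - 1) * (\<pi> (w i) * ?p) * \<pi> (sum_list (map w xs))"
    by (simp only: mult.assoc)
  also have "\<dots> = ((\<pi> (h i) - 1) * ?p) * (\<pi> (w i) * \<pi> (sum_list (map w xs)))"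
    unfolding c by (simp only: mult.assoc)
  finally show ?case by (simp add: Cons \<pi>_add)
qed (simp add: \<pi>_0)

lemma \<pi>_inverse: "\<pi> x * \<pi> (- x) = 1"
  by (metis \<pi>_0 \<pi>_add add.right_inverse)

lemma cancel: "y * \<pi> x = 0 \<longleftrightarrow> y = 0"
proof
  assume "y * \<pi> x = 0"
  then have "y * (\<pi> x * \<pi> (- x)) = 0" by (simp only: mult.assoc[symmetric] mult_zero_left)
  then show "y = 0" by (simp add: \<pi>_inverse)
qed simp

text \<open>
  The characters are \<open>x \<mapsto> \<pi> (S\<^sup>i x)\<close>. A product of differences
  \<open>\<pi> (S\<^sup>D b) - \<pi> (S\<^sup>i b)\<close> vanishes, and each factor is \<open>\<pi> h - 1\<close> up to a unit when
  \<open>h = S\<^sup>D b - S\<^sup>i b\<close>.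
\<close>
lemma unipotent_product:
  assumes m: "m \<in> monic (\<lambda>x. s * x * s') D" "\<And>x. m (\<pi> x) = 0"
    and h: "\<And>i. i < D \<Longrightarrow> (S ^^ D) (b i) = h i + (S ^^ i) (b i)"
  shows "prod_list (map (\<lambda>i. \<pi> (h i) - 1) [0..<D]) = 0"
proof -
  interpret operator "\<lambda>x. s * x * s'" by (rule operator_conj)
  obtain c where c: "\<And>i. central (c i)"
    "\<And>v. m v = ((\<lambda>x. s * x * s') ^^ D) v + (\<Sum>i<D. c i * ((\<lambda>x. s * x * s') ^^ i) v)"
    using monic_coeffs[OF m(1)] by blast
  have rel: "(\<Sum>i<D. \<pi> ((S ^^ i) x) * c i) + \<pi> ((S ^^ D) x) * 1 = 0" for x
  proof -
    have "(\<Sum>i<D. c i * \<pi> ((S ^^ i) x)) = (\<Sum>i<D. \<pi> ((S ^^ i) x) * c i)"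
      using c(1) by (auto simp: central_def)
    then show ?thesis using m(2)[of x] by (simp add: c conj_pow add.commute)
  qed
  have "prod_list (map (\<lambda>i. \<pi> ((S ^^ D) (b i)) - \<pi> ((S ^^ i) (b i))) [0..<D]) * 1 = 0"
    by (rule character_elimination[OF _ _ _ _ _ rel]) (auto simp: S_pow_add S_pow_0 \<pi>_0 \<pi>_add \<pi>_commute)
  also have "map (\<lambda>i. \<pi> ((S ^^ D) (b i)) - \<pi> ((S ^^ i) (b i))) [0..<D]
      = map (\<lambda>i. (\<pi> (h i) - 1) * \<pi> ((S ^^ i) (b i))) [0..<D]"
    by (auto simp: h \<pi>_add algebra_simps)
  finally show ?thesis
    by (simp add: prod_pull cancel)
qed

lemma monic_diff:
  "((\<lambda>x. s * x * s' + - x) ^^ k) \<in> monic (\<lambda>x. s * x * s') k"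
proof (induction k)
  interpret operator "\<lambda>x. s * x * s'" by (rule operator_conj)
  case 0
  show ?case by (auto simp: monic_def id_def)
next
  interpret operator "\<lambda>x. s * x * s'" by (rule operator_conj)
  case (Suc k)
  have "(\<lambda>x. s * x * s' + - x) \<in> monic (\<lambda>x. s * x * s') 1"
    using low_const[OF central_minus[OF central_1]] by (force simp: monic_def)
  from monic_comp[OF this Suc] show ?case by (simp add: o_def)
qed

text \<open>
  \<open>s y s' - y\<close> equals \<open>(s - 1) y s' - y s' (s - 1)\<close>, so each difference adds a factor
  \<open>s - 1\<close> on one of the two sides.
\<close>
lemma diff_nilpotent:
  assumes "(s - 1) ^ d = 0" "2 * d \<le> a + b + k"
  shows "((\<lambda>x. s * x * s' + - x) ^^ k) ((s - 1) ^ a * x * (s - 1) ^ b) = 0"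
  using assms(2)
proof (induction k arbitrary: a b x)
  case 0
  then consider "d \<le> a" | "d \<le> b" by linarith
  then have "(s - 1) ^ a = 0 \<or> (s - 1) ^ b = 0"
    by cases (metis assms(1) le_iff_add mult_zero_left power_add)+
  then show ?case by auto
next
  case (Suc k)
  interpret operator "\<lambda>x. s * x * s'" by (rule operator_conj)
  let ?\<delta> = "\<lambda>x. s * x * s' + - x"
  have comm: "(s - 1) ^ b * s' = s' * (s - 1) ^ b"
    by (rule power_commuting_commutes) (use s in \<open>simp add: algebra_simps\<close>)
  have lin: "(?\<delta> ^^ k) (u + v) = (?\<delta> ^^ k) u + (?\<delta> ^^ k) v" for u v
    using low_additive[OF monic_low[OF monic_diff[of k]]] .
  have lin': "(?\<delta> ^^ k) (- u) = - (?\<delta> ^^ k) u" for u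
    using lin[of u "- u"] lin[of 0 0] by (simp add: eq_neg_iff_add_eq_0 add.commute)
  let ?y = "(s - 1) ^ a * x * (s - 1) ^ b"
  have 1: "s - 1 = (s - 1) * 1" "s' - 1 = - (s' * (s - 1))" using s by (simp_all add: algebra_simps)
  have "?\<delta> ?y = (s - 1) * ?y * s' + ?y * (s' - 1)" by (simp add: algebra_simps)
  also have "(s - 1) * ?y * s' = (s - 1) * ((s - 1) ^ a * x) * ((s - 1) ^ b * s')"
    by (simp only: mult.assoc)
  also have "\<dots> = (s - 1) ^ Suc a * (x * s') * (s - 1) ^ b"
    unfolding comm by (simp only: mult.assoc power_Suc)
  also have "?y * (s' - 1) = - ((s - 1) ^ a * x * ((s - 1) ^ b * s') * (s - 1))"
    unfolding 1(2) by (simp only: mult.assoc mult_minus_right)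
  also have "\<dots> = - ((s - 1) ^ a * (x * s') * (s - 1) ^ Suc b)"
    unfolding comm by (simp only: mult.assoc power_Suc2)
  finally have eq: "?\<delta> ?y = (s - 1) ^ Suc a * (x * s') * (s - 1) ^ b + - ((s - 1) ^ a * (x * s') * (s - 1) ^ Suc b)" .
  have "(?\<delta> ^^ Suc k) ?y = (?\<delta> ^^ k) (?\<delta> ?y)"
    by (simp only: funpow_Suc_right o_apply)
  also have "\<dots> = (?\<delta> ^^ k) ((s - 1) ^ Suc a * (x * s') * (s - 1) ^ b)
      + - (?\<delta> ^^ k) ((s - 1) ^ a * (x * s') * (s - 1) ^ Suc b)"
    unfolding eq lin lin' ..
  also have "(?\<delta> ^^ k) ((s - 1) ^ Suc a * (x * s') * (s - 1) ^ b) = 0"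
    by (rule Suc.IH) (use Suc.prems in simp)
  also have "(?\<delta> ^^ k) ((s - 1) ^ a * (x * s') * (s - 1) ^ Suc b) = 0"
    by (rule Suc.IH) (use Suc.prems in simp)
  finally show ?case by (simp only: minus_zero add_0_right)
qed

definition stable :: "'g set \<Rightarrow> bool"
  where "stable A \<longleftrightarrow> (\<forall>x\<in>A. \<forall>y\<in>A. x - y \<in> A) \<and> (\<forall>x\<in>A. S x \<in> A \<and> S' x \<in> A)"

text \<open>Over a set closed under addition this says that its augmentation ideal is nilpotent of index \<open>k\<close>.\<close>
definition products_vanish :: "nat \<Rightarrow> 'g set \<Rightarrow> bool"
  where "products_vanish k A \<longleftrightarrow>
    (\<forall>hs. length hs = k \<longrightarrow> set hs \<subseteq> A \<longrightarrow> prod_list (map (\<lambda>h. \<pi> h - 1) hs) = 0)"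

abbreviation \<Delta> :: "'g \<Rightarrow> 'g" where "\<Delta> x \<equiv> S x - x"

lemma S_diff: "S (x - y) = S x - S y"
  by (metis S_add add_diff_cancel diff_add_cancel)
lemma S'_diff: "S' (x - y) = S' x - S' y"
  by (metis S_diff SS')

lemma \<Delta>_pow_diff: "(\<Delta> ^^ k) (x - y) = (\<Delta> ^^ k) x - (\<Delta> ^^ k) y"
  by (induction k) (auto simp: S_diff)
lemma \<Delta>_pow_S: "(\<Delta> ^^ k) (S x) = S ((\<Delta> ^^ k) x)" "(\<Delta> ^^ k) (S' x) = S' ((\<Delta> ^^ k) x)"
  by (induction k) (auto simp: S_diff S'_diff SS')

lemma \<Delta>_pow_stable: "stable A \<Longrightarrow> x \<in> A \<Longrightarrow> (\<Delta> ^^ k) x \<in> A"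
  by (induction k) (auto simp: stable_def)

lemma stable_image: "stable A \<Longrightarrow> stable ((\<Delta> ^^ k) ` A)"
  unfolding stable_def by (force simp: \<Delta>_pow_diff[symmetric] \<Delta>_pow_S[symmetric])

text \<open>
  Modulo the annihilator of all products of \<open>j\<close> factors, \<open>h \<mapsto> \<pi> h - 1\<close> is additive on \<open>A\<close>, since a
  product of two such differences is killed. It therefore transforms \<open>\<Delta>\<close> into the operator
  \<open>y \<mapsto> s y s' - y\<close>, whose \<open>k\<close>-th power is zero. So on \<open>\<Delta>\<^sup>k A\<close> one factor fewer suffices.
\<close>
lemma products_vanish_step:
  assumes A: "stable A" and v: "products_vanish (Suc (Suc j)) A"
    and k: "\<And>x. ((\<lambda>x. s * x * s' + - x) ^^ k) x = 0"
  shows "products_vanish (Suc j) ((\<Delta> ^^ k) ` A)"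
proof -
  let ?\<delta> = "\<lambda>x. s * x * s' + - x"
  define w where "w hs = prod_list (map (\<lambda>h. \<pi> h - 1) hs)" for hs
  \<comment> \<open>Stability under \<open>S'\<close> lets \<open>s\<close> be moved past a product, so that the induction on \<open>r\<close> below may
    use a conjugated product.\<close>
  have conj_w: "s' * w hs * s = w (map S' hs)" for hs
  proof (induction hs)
    case (Cons h hs)
    have "s' * w (h # hs) * s = (s' * (\<pi> h - 1) * s) * (s' * w hs * s)"
    proof -
      have "(s' * (\<pi> h - 1) * s) * (s' * w hs * s) = s' * (\<pi> h - 1) * (s * s') * (w hs * s)"
        by (simp only: mult.assoc)
      then show ?thesis by (simp add: s(1)) (simp add: w_def mult.assoc)
    qed
    also have "s' * (\<pi> h - 1) * s = \<pi> (S' h) - 1"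
      by (simp add: right_diff_distrib left_diff_distrib conj s)
    finally show ?case by (simp add: Cons) (simp add: w_def)
  qed (simp add: w_def s)
  have kill: "w hs * (\<pi> x - 1) * (\<pi> y - 1) = 0"
    if "length hs = j" "set hs \<subseteq> A" "x \<in> A" "y \<in> A" for hs x y
    using v[unfolded products_vanish_def, rule_format, of "hs @ [x, y]"] that
    by (simp add: w_def mult.assoc)
  have main: "w hs * (\<pi> ((\<Delta> ^^ r) u) - 1) = w hs * (?\<delta> ^^ r) (\<pi> u - 1)"
    if "length hs = j" "set hs \<subseteq> A" "u \<in> A" for hs u r
    using that
  proof (induction r arbitrary: hs)
    case (Suc r)
    define x where "x = (\<Delta> ^^ r) u"
    define z where "z = (?\<delta> ^^ r) (\<pi> u - 1)"
    have x: "x \<in> A" "S x \<in> A" "- x \<in> A"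
    proof -
      show xA: "x \<in> A" unfolding x_def by (rule \<Delta>_pow_stable[OF A]) fact
      then show "S x \<in> A" using A by (simp add: stable_def)
      have "x - x \<in> A" using A xA unfolding stable_def by blast
      then have "(x - x) - x \<in> A" using A xA unfolding stable_def by blast
      then show "- x \<in> A" by simp
    qed
    have 1: "w hs * (\<pi> x - 1) = w hs * z"
      using Suc by (simp add: x_def z_def)
    have 2: "w (map S' hs) * (\<pi> x - 1) = w (map S' hs) * z"
      unfolding x_def z_def using A Suc.prems by (intro Suc.IH) (auto simp: stable_def)
    have un: "s * (s' * w hs * s) * y * s' = w hs * (s * y * s')" for y
    proof -
      have "s * (s' * w hs * s) * y * s' = (s * s') * w hs * (s * y * s')" by (simp only: mult.assoc)
      then show ?thesis by (simp add: s(1))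
    qed
    have "w hs * (s * (\<pi> x - 1) * s') = s * (w (map S' hs) * (\<pi> x - 1)) * s'"
      unfolding un[symmetric] conj_w by (simp only: mult.assoc)
    also have "\<dots> = w hs * (s * z * s')"
      unfolding 2 un[symmetric] conj_w by (simp only: mult.assoc)
    finally have 3: "w hs * (s * (\<pi> x - 1) * s') = w hs * (s * z * s')" .
    have 4: "s * (\<pi> x - 1) * s' = \<pi> (S x) - 1"
      by (simp add: right_diff_distrib left_diff_distrib conj s)
    have 5: "\<pi> (S x - x) = \<pi> (S x) * \<pi> (- x)" "\<pi> x * \<pi> (- x) = 1"
      by (simp_all flip: \<pi>_add add: \<pi>_0)
    have "\<pi> (S x - x) - 1 = ((\<pi> (S x) - 1) - (\<pi> x - 1)) + ((\<pi> (S x) - 1) - (\<pi> x - 1)) * (\<pi> (- x) - 1)"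
      unfolding 5(1) using 5(2) by (simp add: algebra_simps)
    moreover have expand: "w hs * ((a - c) + (a - c) * e) = w hs * (a - c) + (w hs * a * e - w hs * c * e)"
      for a c e by (simp add: algebra_simps)
    ultimately have "w hs * (\<pi> (S x - x) - 1) = w hs * ((\<pi> (S x) - 1) - (\<pi> x - 1))
        + (w hs * (\<pi> (S x) - 1) * (\<pi> (- x) - 1) - w hs * (\<pi> x - 1) * (\<pi> (- x) - 1))"
      by (simp only:)
    also have "\<dots> = w hs * (\<pi> (S x) - 1) - w hs * (\<pi> x - 1)"
      using kill[OF Suc.prems(1,2) x(2,3)] kill[OF Suc.prems(1,2) x(1,3)]
      by (simp add: right_diff_distrib)
    also have "\<dots> = w hs * (s * z * s' + - z)"
      unfolding 1 4[symmetric] 3 by (simp add: algebra_simps)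
    finally show ?case by (simp add: x_def z_def)
  qed simp
  show ?thesis unfolding products_vanish_def
  proof (intro allI impI)
    fix hs :: "'g list" assume hs: "length hs = Suc j" "set hs \<subseteq> (\<Delta> ^^ k) ` A"
    then obtain gs h where gh: "hs = gs @ [h]" by (metis append_butlast_last_id length_0_conv nat.distinct(1))
    then obtain u where u: "h = (\<Delta> ^^ k) u" "u \<in> A" using hs by auto
    have "set gs \<subseteq> A" using hs gh \<Delta>_pow_stable[OF A] by auto
    then have "w gs * (\<pi> h - 1) = 0" unfolding u(1) using main[of gs u k] k u hs gh by simp
    then show "prod_list (map (\<lambda>h. \<pi> h - 1) hs) = 0" by (simp add: gh w_def)
  qed
qed

lemma iterated_difference_trivial:
  assumes "stable A" "products_vanish (Suc j) A"
    and k: "\<And>x. ((\<lambda>x. s * x * s' + - x) ^^ k) x = 0" and "h \<in> A"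
  shows "\<pi> ((\<Delta> ^^ (k * j)) h) = 1"
  using assms(1,2,4)
proof (induction j arbitrary: A h)
  case 0
  then show ?case unfolding products_vanish_def by (auto dest!: spec[of _ "[h]"])
next
  case (Suc j)
  have "\<pi> ((\<Delta> ^^ (k * j)) ((\<Delta> ^^ k) h)) = 1"
    using Suc.IH[OF stable_image products_vanish_step[OF _ _ k]] Suc.prems by blast
  moreover have "(\<Delta> ^^ (k * Suc j)) h = (\<Delta> ^^ (k * j)) ((\<Delta> ^^ k) h)"
    using fun_cong[OF funpow_add[of "k * j" k \<Delta>], of h] by (simp only: mult_Suc_right add.commute o_apply)
  ultimately show ?case by (simp only:)
qed

text \<open>
  Unipotence of \<open>s\<close> makes conjugation by \<open>s\<close> unipotent, which is a monic relation of degree \<open>2 d\<close>.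
  Hence products of \<open>2 d\<close> factors \<open>\<pi> h - 1\<close> vanish on the stable group of all \<open>h\<close> that lie in the image of
  each \<open>S\<^bsup>2 d\<^esup> - S\<^sup>i\<close>. Applying \<open>\<Delta>\<^bsup>2 d\<^esup>\<close> repeatedly then reduces the number of factors to one.
\<close>
theorem nilpotent_action_bound:
  assumes s1: "(s - 1) ^ d = 0"
    and h: "\<And>i. i < 2 * d \<Longrightarrow> \<exists>b. (S ^^ (2 * d)) b - (S ^^ i) b = h"
  shows "\<pi> ((\<Delta> ^^ (2 * d * (2 * d))) h) = 1"
proof -
  define A where "A = {h. \<forall>i<2 * d. \<exists>b. (S ^^ (2 * d)) b - (S ^^ i) b = h}"
  have k: "((\<lambda>x. s * x * s' + - x) ^^ (2 * d)) x = 0" for x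
    using diff_nilpotent[OF s1, of 0 0 "2 * d" x] by simp
  have Spd: "(S ^^ i) (x - y) = (S ^^ i) x - (S ^^ i) y" for i x y
    by (induction i) (auto simp: S_diff)
  have SpS: "(S ^^ i) (S x) = S ((S ^^ i) x)" "(S ^^ i) (S' x) = S' ((S ^^ i) x)" for i x
    by (induction i) (auto simp: SS')
  have "stable A"
    unfolding stable_def
  proof (intro conjI ballI)
    fix x y assume xy: "x \<in> A" "y \<in> A"
    show "x - y \<in> A" unfolding A_def
    proof (intro CollectI allI impI)
      fix i assume "i < 2 * d"
      then obtain b c where "(S ^^ (2 * d)) b - (S ^^ i) b = x" "(S ^^ (2 * d)) c - (S ^^ i) c = y"
        using xy unfolding A_def by blast
      then show "\<exists>b. (S ^^ (2 * d)) b - (S ^^ i) b = x - y"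
        by (intro exI[of _ "b - c"]) (auto simp: Spd)
    qed
    show "S x \<in> A" "S' x \<in> A"
      using xy(1) unfolding A_def by (auto simp: S_diff S'_diff) (metis SpS S_diff S'_diff)+
  qed
  moreover have "products_vanish (Suc (2 * d)) A"
    unfolding products_vanish_def
  proof (intro allI impI)
    fix hs assume hs: "length hs = Suc (2 * d)" "set hs \<subseteq> A"
    have "\<exists>b. (S ^^ (2 * d)) b = hs ! i + (S ^^ i) b" if "i < 2 * d" for i
    proof -
      have "hs ! i \<in> A" using hs that by (intro subsetD[OF hs(2)] nth_mem) simp
      then show ?thesis using that unfolding A_def by (auto simp: diff_eq_eq)
    qed
    then obtain b where b: "\<And>i. i < 2 * d \<Longrightarrow> (S ^^ (2 * d)) (b i) = hs ! i + (S ^^ i) (b i)" by metis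
    have "prod_list (map (\<lambda>i. \<pi> (hs ! i) - 1) [0..<2 * d]) = 0"
      by (rule unipotent_product[OF monic_diff k b])
    also have "map (\<lambda>i. \<pi> (hs ! i) - 1) [0..<2 * d] = map (\<lambda>h. \<pi> h - 1) (take (2 * d) hs)"
      using hs by (intro nth_equalityI) auto
    finally have "prod_list (map (\<lambda>h. \<pi> h - 1) (take (2 * d) hs @ drop (2 * d) hs)) = 0"
      by (simp only: map_append prod_list.append mult_zero_left)
    then show "prod_list (map (\<lambda>h. \<pi> h - 1) hs) = 0" by simp
  qed
  moreover have "h \<in> A" using h by (auto simp: A_def)
  ultimately show ?thesis using iterated_difference_trivial k by blast
qed

end

section \<open>Substitution in three variables\<close>

text \<open>
  Substitution is a ring homomorphism, and ring homomorphisms on \<open>K[z,x,y]\<close> that agree on the constants and the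
  variables are equal; the monoid laws of \<^const>\<open>End_A3\<close> follow.
\<close>
definition unital_hom :: "('a::comm_ring_1 \<Rightarrow> 'b::comm_ring_1) \<Rightarrow> bool"
  where "unital_hom F \<longleftrightarrow> F 0 = 0 \<and> F 1 = 1 \<and>
    (\<forall>x y. F (x + y) = F x + F y) \<and> (\<forall>x y. F (x * y) = F x * F y)"

lemma eval_pCons:
  assumes "F 0 = 0"
  shows "poly (map_poly F (pCons a p)) h = F a + h * poly (map_poly F p) h"
  using assms by (simp add: map_poly_pCons)

lemma unital_hom_eval:
  assumes F: "unital_hom F"
  shows "unital_hom (\<lambda>p. poly (map_poly F p) h)"
proof -
  have 0: "F 0 = 0" using F by (simp add: unital_hom_def)
  note [simp] = eval_pCons[where F = F, OF 0]
  let ?E = "\<lambda>p. poly (map_poly F p) h"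
  have add: "?E (p + q) = ?E p + ?E q" for p q
    by (induction p q rule: poly_induct2) (use F in \<open>auto simp: unital_hom_def algebra_simps\<close>)
  have smult: "?E (smult a p) = F a * ?E p" for a p
    by (induction p) (use F in \<open>auto simp: unital_hom_def algebra_simps\<close>)
  have "?E (p * q) = ?E p * ?E q" for p q
  proof (induction p)
    case (pCons a p)
    have "?E (pCons a p * q) = ?E (smult a q) + ?E (pCons 0 (p * q))" by (simp add: add)
    then show ?case using pCons by (simp add: smult algebra_simps 0)
  qed simp
  then show ?thesis using add F by (auto simp: unital_hom_def one_pCons simp del: pCons_one)
qed

lemma subst3_eq:
  "subst3 (f, g, h) =
    (\<lambda>p. poly (map_poly (\<lambda>q. poly (map_poly (\<lambda>r. poly (map_poly const3 r) f) q) g) p) h)"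
  by (simp add: subst3_def)

lemma unital_hom_const3: "unital_hom (const3 :: 'k::field \<Rightarrow> _)"
  by (auto simp: unital_hom_def const3_def pCons_one)

lemma unital_hom_subst3: "unital_hom (subst3 \<phi>)"
  by (cases \<phi>) (simp add: subst3_eq unital_hom_eval unital_hom_const3)

lemma subst3_hom:
  "subst3 \<phi> 0 = 0" "subst3 \<phi> 1 = 1"
  "subst3 \<phi> (p + q) = subst3 \<phi> p + subst3 \<phi> q"
  "subst3 \<phi> (p * q) = subst3 \<phi> p * subst3 \<phi> q"
  using unital_hom_subst3[of \<phi>] by (auto simp: unital_hom_def)

lemma subst3_minus: "subst3 \<phi> (- p) = - subst3 \<phi> p"
  using subst3_hom(3)[of \<phi> p "- p"] by (simp add: subst3_hom(1) eq_neg_iff_add_eq_0 add.commute)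

lemma subst3_const: "subst3 \<phi> (const3 c) = const3 c"
  by (cases \<phi>) (simp add: subst3_eq const3_def map_poly_pCons)

lemma subst3_vars:
  "subst3 (f, g, h) var_z = f" "subst3 (f, g, h) var_x = g" "subst3 (f, g, h) var_y = h"
  by (simp_all add: subst3_eq var_z_def var_x_def var_y_def map_poly_pCons const3_def pCons_one)

lemma pCons_expansions:
  "[:[:pCons c r:]:] = const3 c + var_z * [:[:r:]:]"
  "[:pCons r q:] = [:[:r:]:] + var_x * [:q:]"
  "pCons q p = [:q:] + var_y * p" for p :: "'k::field poly3"
  by (simp_all add: const3_def var_z_def var_x_def var_y_def)

lemma unital_hom_unique:
  fixes F G :: "'k::field poly3 \<Rightarrow> 'b::comm_ring_1"
  assumes F: "unital_hom F" and G: "unital_hom G"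
    and "\<And>c. F (const3 c) = G (const3 c)" "F var_z = G var_z" "F var_x = G var_x" "F var_y = G var_y"
  shows "F p = G p"
proof -
  note hom = assms(3-) F[unfolded unital_hom_def] G[unfolded unital_hom_def]
  have 1: "F [:[:r:]:] = G [:[:r:]:]" for r
  proof (induction r)
    case (pCons c r)
    show ?case by (simp only: pCons_expansions(1)[of c r] hom pCons.IH)
  qed (simp add: hom)
  have 2: "F [:q:] = G [:q:]" for q
  proof (induction q)
    case (pCons r q)
    show ?case by (simp only: pCons_expansions(2)[of r q] hom 1 pCons.IH)
  qed (simp add: hom)
  show ?thesis
  proof (induction p)
    case (pCons q p)
    show ?case by (simp only: pCons_expansions(3)[of q p] hom 2 pCons.IH)
  qed (simp add: hom)
qed

lemma subst3_id: "subst3 (var_z, var_x, var_y) p = p"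
  by (rule unital_hom_unique[OF unital_hom_subst3, of "\<lambda>p. p"])
    (simp_all add: subst3_vars subst3_const, simp add: unital_hom_def)

lemma subst3_subst3:
  "subst3 \<psi> (subst3 (f, g, h) p) = subst3 (subst3 \<psi> f, subst3 \<psi> g, subst3 \<psi> h) p"
  by (rule unital_hom_unique[of "\<lambda>p. subst3 \<psi> (subst3 (f, g, h) p)" "subst3 (subst3 \<psi> f, subst3 \<psi> g, subst3 \<psi> h)"])
    (simp_all add: subst3_vars subst3_const unital_hom_subst3, simp add: unital_hom_def subst3_hom)

lemma subst3_z_only: "subst3 (var_z, g, h) [:[:r:]:] = [:[:r:]:]"
proof (induction r)
  case (pCons c r)
  then show ?case by (simp only: pCons_expansions(1)[of c r] subst3_hom subst3_const subst3_vars)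
qed (simp add: subst3_hom)

lemma subst3_zx_only:
  "subst3 (var_z, var_x + [:[:f:]:], h) [:g:] = [:pcompose g [:f, 1:]:]"
proof (induction g)
  case (pCons r g)
  have "subst3 (var_z, var_x + [:[:f:]:], h) [:pCons r g:]
      = [:[:r:]:] + (var_x + [:[:f:]:]) * [:pcompose g [:f, 1:]:]"
    by (simp only: pCons_expansions(2)[of r g] subst3_hom subst3_z_only subst3_vars pCons)
  also have "\<dots> = [:pcompose (pCons r g) [:f, 1:]:]"
    by (simp add: pcompose_pCons var_x_def algebra_simps)
  finally show ?case .
qed (simp add: subst3_hom)

section \<open>Elementary automorphisms\<close>

lemma End_mult: "(f, g, h) \<otimes>\<^bsub>End_A3\<^esub> \<psi> = (subst3 \<psi> f, subst3 \<psi> g, subst3 \<psi> h)"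
  by (simp add: End_A3_def)

lemma End_one: "\<one>\<^bsub>End_A3\<^esub> = (var_z, var_x, var_y)"
  by (simp add: End_A3_def)

lemma End_monoid: "Group.monoid End_A3"
proof (rule monoidI)
  fix \<phi> \<psi> \<chi> :: "'k::field poly3 \<times> 'k poly3 \<times> 'k poly3"
  show "\<phi> \<otimes>\<^bsub>End_A3\<^esub> \<psi> \<otimes>\<^bsub>End_A3\<^esub> \<chi> = \<phi> \<otimes>\<^bsub>End_A3\<^esub> (\<psi> \<otimes>\<^bsub>End_A3\<^esub> \<chi>)"
    by (cases \<phi>, cases \<psi>) (simp add: End_mult subst3_subst3)
  show "\<one>\<^bsub>End_A3\<^esub> \<otimes>\<^bsub>End_A3\<^esub> \<phi> = \<phi>" by (cases \<phi>) (simp add: End_one End_mult subst3_vars)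
  show "\<phi> \<otimes>\<^bsub>End_A3\<^esub> \<one>\<^bsub>End_A3\<^esub> = \<phi>" by (cases \<phi>) (simp add: End_one End_mult subst3_id)
qed (simp_all add: End_A3_def)

text \<open>
  All three kinds of maps carry a factor \<open>P\<close>, so that they belong to \<^term>\<open>Aut_mod_set \<mm>\<close> as soon as
  \<open>P \<in> \<mm>\<close>.
\<close>
definition translation :: "'k::field poly \<Rightarrow> 'k poly \<times> 'k poly \<Rightarrow> 'k poly3 \<times> 'k poly3 \<times> 'k poly3"
  where "translation P v = (var_z, var_x + [:[:P * fst v:]:], var_y + [:[:P * snd v:]:])"

definition y_shift :: "'k::field poly \<Rightarrow> 'k poly poly \<Rightarrow> 'k poly3 \<times> 'k poly3 \<times> 'k poly3"
  where "y_shift P g = (var_z, var_x, var_y + [:smult P g:])"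

definition x_shear :: "'k::field poly \<Rightarrow> 'k poly3 \<times> 'k poly3 \<times> 'k poly3"
  where "x_shear P = (var_z, var_x + [:[:P:]:] * var_y, var_y)"

lemma subst3_fix: "subst3 (var_z, var_x, h) [:g:] = [:g:]"
  using subst3_zx_only[of 0 h g] by (simp add: pcompose_idR)

lemmas subst3_simps = subst3_hom subst3_vars subst3_const subst3_z_only subst3_zx_only subst3_fix

lemma translation_mult: "translation P v \<otimes>\<^bsub>End_A3\<^esub> translation P w = translation P (v + w)"
  unfolding translation_def End_mult subst3_simps by (simp add: algebra_simps)

lemma y_shift_mult: "y_shift P g \<otimes>\<^bsub>End_A3\<^esub> y_shift P h = y_shift P (g + h)"
  unfolding y_shift_def End_mult subst3_simps by (simp add: algebra_simps smult_add_right)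

lemma x_shear_mult: "x_shear P \<otimes>\<^bsub>End_A3\<^esub> x_shear Q = x_shear (P + Q)"
  unfolding x_shear_def End_mult subst3_simps by (simp add: algebra_simps flip: smult_add_left)

lemma x_shear_translation:
  "x_shear P \<otimes>\<^bsub>End_A3\<^esub> translation P (a, b) = translation P (a + P * b, b) \<otimes>\<^bsub>End_A3\<^esub> x_shear P"
  unfolding x_shear_def translation_def End_mult subst3_simps fst_conv snd_conv
  by (simp add: algebra_simps)

lemma y_shift_x_translation:
  "y_shift P [:0, 1:] \<otimes>\<^bsub>End_A3\<^esub> translation P (a, b)
    = translation P (a, b + P * a) \<otimes>\<^bsub>End_A3\<^esub> y_shift P [:0, 1:]"
  unfolding y_shift_def translation_def End_mult subst3_simps fst_conv snd_conv
  by (simp add: algebra_simps pcompose_pCons)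

lemma translation_y_shift:
  "translation P (a, b) \<otimes>\<^bsub>End_A3\<^esub> y_shift P g
    = y_shift P (pcompose g [:- (P * a), 1:]) \<otimes>\<^bsub>End_A3\<^esub> translation P (a, b)"
proof -
  have "pcompose (pcompose g [:- (P * a), 1:]) [:P * a, 1:] = g"
    by (simp add: pcompose_assoc[symmetric] pcompose_pCons pcompose_idR)
  then show ?thesis
    unfolding y_shift_def translation_def End_mult subst3_simps fst_conv snd_conv
    by (simp add: algebra_simps pcompose_smult)
qed

lemma Aut_simps:
  "monoid.mult Aut_A3 = monoid.mult End_A3" "one Aut_A3 = one End_A3"
  "carrier Aut_A3 = Units End_A3"
  "monoid.mult (TAut_mod \<mm>) = monoid.mult End_A3" "one (TAut_mod \<mm>) = one End_A3"
  by (simp_all add: Aut_A3_def units_of_def TAut_mod_def)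

lemma End_carrier: "\<phi> \<in> carrier End_A3"
  by (simp add: End_A3_def)

lemma Aut_memI:
  "\<phi> \<otimes>\<^bsub>End_A3\<^esub> \<psi> = \<one>\<^bsub>End_A3\<^esub> \<Longrightarrow> \<psi> \<otimes>\<^bsub>End_A3\<^esub> \<phi> = \<one>\<^bsub>End_A3\<^esub> \<Longrightarrow> \<phi> \<in> carrier Aut_A3"
  unfolding Aut_simps Units_def by (auto simp: End_carrier)

lemma trivial_elementary:
  "translation P 0 = \<one>\<^bsub>End_A3\<^esub>" "y_shift P 0 = \<one>\<^bsub>End_A3\<^esub>" "x_shear 0 = \<one>\<^bsub>End_A3\<^esub>"
  by (simp_all add: translation_def y_shift_def x_shear_def End_one)

lemma elementary_inverse:
  "translation P v \<otimes>\<^bsub>End_A3\<^esub> translation P (- v) = \<one>\<^bsub>End_A3\<^esub>"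
  "translation P (- v) \<otimes>\<^bsub>End_A3\<^esub> translation P v = \<one>\<^bsub>End_A3\<^esub>"
  "y_shift P g \<otimes>\<^bsub>End_A3\<^esub> y_shift P (- g) = \<one>\<^bsub>End_A3\<^esub>"
  "y_shift P (- g) \<otimes>\<^bsub>End_A3\<^esub> y_shift P g = \<one>\<^bsub>End_A3\<^esub>"
  "x_shear Q \<otimes>\<^bsub>End_A3\<^esub> x_shear (- Q) = \<one>\<^bsub>End_A3\<^esub>"
  "x_shear (- Q) \<otimes>\<^bsub>End_A3\<^esub> x_shear Q = \<one>\<^bsub>End_A3\<^esub>"
  by (simp_all add: translation_mult y_shift_mult x_shear_mult trivial_elementary)

lemma elementary_Aut:
  "translation P v \<in> carrier Aut_A3" "y_shift P g \<in> carrier Aut_A3" "x_shear P \<in> carrier Aut_A3"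
  by (rule Aut_memI, rule elementary_inverse, rule elementary_inverse)+

text \<open>
  Only the shear is not triangular. It is the conjugate of the triangular map \<open>y \<mapsto> y + P x\<close> by the linear
  map exchanging \<open>x\<close> and \<open>y\<close>.
\<close>
lemma elementary_TAut:
  "translation P v \<in> TAut_A3_set" "y_shift P g \<in> TAut_A3_set" "x_shear P \<in> TAut_A3_set"
proof -
  have "translation P v \<in> Triangular3"
    by (auto simp: Triangular3_def translation_def)
  then show "translation P v \<in> TAut_A3_set"
    unfolding TAut_A3_set_def by (intro generate.incl) simp
  have "y_shift P g \<in> Triangular3" for g
    unfolding Triangular3_def y_shift_def by (auto intro!: exI[of _ 0])
  then show y: "y_shift P g \<in> TAut_A3_set" for g
    unfolding TAut_A3_set_def by (intro generate.incl) simp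
  define w :: "'a poly3 \<times> 'a poly3 \<times> 'a poly3" where "w = (var_z, var_y, var_x)"
  have "w \<otimes>\<^bsub>End_A3\<^esub> w = \<one>\<^bsub>End_A3\<^esub>" unfolding w_def End_mult End_one subst3_simps ..
  then have "w \<in> carrier Aut_A3" by (intro Aut_memI[of w w])
  moreover have "affine_poly3 var_z" "affine_poly3 var_x" "affine_poly3 var_y"
    unfolding affine_poly3_def
    by (rule exI[of _ 1], rule exI[of _ 0], rule exI[of _ 0], rule exI[of _ 0], simp add: const3_def pCons_one,
        rule exI[of _ 0], rule exI[of _ 1], rule exI[of _ 0], rule exI[of _ 0], simp add: const3_def pCons_one,
        rule exI[of _ 0], rule exI[of _ 0], rule exI[of _ 1], rule exI[of _ 0], simp add: const3_def pCons_one)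
  ultimately have w: "w \<in> TAut_A3_set"
    unfolding TAut_A3_set_def by (intro generate.incl UnI1) (simp add: Aff3_def w_def)
  have "[:smult P [:0, 1:]:] = [:[:P:]:] * var_x" by (simp add: var_x_def)
  then have "x_shear P = w \<otimes>\<^bsub>End_A3\<^esub> (y_shift P [:0, 1:] \<otimes>\<^bsub>End_A3\<^esub> w)"
    unfolding x_shear_def y_shift_def w_def End_mult by (simp only: End_mult subst3_simps)
  then show "x_shear P \<in> TAut_A3_set"
    using generate.eng[OF w[unfolded TAut_A3_set_def] generate.eng[OF y[unfolded TAut_A3_set_def] w[unfolded TAut_A3_set_def]]]
    by (simp add: TAut_A3_set_def Aut_simps)
qed

lemma TAut_mult: "\<phi> \<in> TAut_A3_set \<Longrightarrow> \<psi> \<in> TAut_A3_set \<Longrightarrow> \<phi> \<otimes>\<^bsub>End_A3\<^esub> \<psi> \<in> TAut_A3_set"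
  unfolding TAut_A3_set_def using generate.eng[of \<phi> Aut_A3 _ \<psi>] by (simp add: Aut_simps)

lemma Aut_mult: "\<phi> \<in> carrier Aut_A3 \<Longrightarrow> \<psi> \<in> carrier Aut_A3 \<Longrightarrow> \<phi> \<otimes>\<^bsub>End_A3\<^esub> \<psi> \<in> carrier Aut_A3"
  unfolding Aut_simps by (rule monoid.Units_m_closed[OF End_monoid])

context
  fixes \<mm> :: "'k::field poly3 set" and P :: "'k poly"
  assumes ideal: "ideal \<mm> poly3_ring" and P: "[:[:P:]:] \<in> \<mm>"
begin

lemma multiple_mem: "[:[:P:]:] * a \<in> \<mm>"
  using ideal.I_r_closed[OF ideal P, of a] by (simp add: poly3_ring_def ring_of_type_algebra_def)

lemma TAut_mod_memI:
  assumes "\<phi> \<in> TAut_A3_set" "\<phi> \<in> carrier Aut_A3"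
    "\<phi> = (var_z + [:[:P:]:] * a, var_x + [:[:P:]:] * b, var_y + [:[:P:]:] * c)"
  shows "\<phi> \<in> carrier (TAut_mod \<mm>)"
proof -
  have "\<phi> \<in> Aut_mod_set \<mm>"
    unfolding Aut_mod_set_def using assms(2) multiple_mem assms(3) by blast
  then show ?thesis using assms(1) by (simp add: TAut_mod_def)
qed

lemma elementary_mem:
  "translation P v \<in> carrier (TAut_mod \<mm>)" "y_shift P g \<in> carrier (TAut_mod \<mm>)"
  "x_shear P \<in> carrier (TAut_mod \<mm>)" "x_shear (- P) \<in> carrier (TAut_mod \<mm>)"
  "x_shear P \<otimes>\<^bsub>End_A3\<^esub> y_shift P [:0, 1:] \<in> carrier (TAut_mod \<mm>)"
  "y_shift P (- [:0, 1:]) \<otimes>\<^bsub>End_A3\<^esub> x_shear (- P) \<in> carrier (TAut_mod \<mm>)"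
proof -
  note mem = elementary_Aut elementary_TAut Aut_mult TAut_mult
  show "translation P v \<in> carrier (TAut_mod \<mm>)"
    by (rule TAut_mod_memI[where a = 0 and b = "[:[:fst v:]:]" and c = "[:[:snd v:]:]"])
      (simp_all add: mem, simp add: translation_def)
  show "y_shift P g \<in> carrier (TAut_mod \<mm>)"
    by (rule TAut_mod_memI[where a = 0 and b = 0 and c = "[:g:]"])
      (simp_all add: mem, simp add: y_shift_def)
  show "x_shear P \<in> carrier (TAut_mod \<mm>)"
    by (rule TAut_mod_memI[where a = 0 and b = var_y and c = 0])
      (simp_all add: mem, simp add: x_shear_def)
  have minus: "smult [:- P:] q = - smult [:P:] q" for q :: "'k poly3"
    using smult_minus_left[of "[:P:]" q] by simp
  show "x_shear (- P) \<in> carrier (TAut_mod \<mm>)"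
    by (rule TAut_mod_memI[where a = 0 and b = "- var_y" and c = 0])
      (simp_all add: mem, simp add: x_shear_def minus)
  have x: "[:smult P [:0, 1:]:] = [:[:P:]:] * var_x" "[:smult P (- [:0, 1:]):] = - ([:[:P:]:] * var_x)"
    by (simp_all add: var_x_def)
  have neg: "[:[:- P:]:] = - [:[:P:]:]" by simp
  show "x_shear P \<otimes>\<^bsub>End_A3\<^esub> y_shift P [:0, 1:] \<in> carrier (TAut_mod \<mm>)"
    by (rule TAut_mod_memI[where a = 0 and b = "var_y + [:[:P:]:] * var_x" and c = var_x])
      (simp_all only: mem, simp only: x_shear_def y_shift_def x End_mult subst3_simps mult_zero_right add_0_right)
  show "y_shift P (- [:0, 1:]) \<otimes>\<^bsub>End_A3\<^esub> x_shear (- P) \<in> carrier (TAut_mod \<mm>)"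
    by (rule TAut_mod_memI[where a = 0 and b = "- var_y" and c = "[:[:P:]:] * var_y - var_x"])
      (simp_all only: mem, simp only: x_shear_def y_shift_def x neg End_mult subst3_simps subst3_minus mult_zero_right add_0_right,
       simp add: algebra_simps del: mult_pCons_left mult_pCons_right minus_pCons)
qed

end

locale rep_mod =
  fixes \<mm> :: "'k::field poly3 set" and P :: "'k poly"
    and \<pi> :: "'k poly3 \<times> 'k poly3 \<times> 'k poly3 \<Rightarrow> 'a::{ring,monoid_mult}" and D :: nat
  assumes ideal: "ideal \<mm> poly3_ring" and P: "[:[:P:]:] \<in> \<mm>" "P \<noteq> 0"
    and rep: "linear_rep (TAut_mod \<mm>) \<pi> D"
begin

lemmas mem = elementary_mem[OF ideal P(1)]

lemma \<pi>_mult: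
  "\<phi> \<in> carrier (TAut_mod \<mm>) \<Longrightarrow> \<psi> \<in> carrier (TAut_mod \<mm>) \<Longrightarrow> \<pi> (\<phi> \<otimes>\<^bsub>End_A3\<^esub> \<psi>) = \<pi> \<phi> * \<pi> \<psi>"
  using rep by (simp add: linear_rep_def Aut_simps)

lemma \<pi>_one: "\<pi> \<one>\<^bsub>End_A3\<^esub> = 1"
  using rep by (simp add: linear_rep_def Aut_simps)

lemma \<pi>_inj: "\<pi> \<phi> = \<pi> \<psi> \<Longrightarrow> \<phi> \<in> carrier (TAut_mod \<mm>) \<Longrightarrow> \<psi> \<in> carrier (TAut_mod \<mm>) \<Longrightarrow> \<phi> = \<psi>"
  using rep by (auto simp: linear_rep_def inj_on_def)

lemma \<pi>_integral:
  assumes "s \<in> carrier (TAut_mod \<mm>)" "s' \<in> carrier (TAut_mod \<mm>)" "s \<otimes>\<^bsub>End_A3\<^esub> s' = \<one>\<^bsub>End_A3\<^esub>"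
  shows "\<exists>m \<in> monic (\<lambda>y. \<pi> s * y * \<pi> s') D. \<forall>\<phi>\<in>carrier (TAut_mod \<mm>). m (\<pi> \<phi>) = 0"
  using rep assms unfolding linear_rep_def Aut_simps by blast

lemma y_shift_inj: "y_shift P g = y_shift P h \<Longrightarrow> g = h"
proof -
  assume "y_shift P g = y_shift P h"
  then have "smult P (g - h) = 0" by (simp add: y_shift_def smult_diff_right)
  then show ?thesis using P(2) by simp
qed

lemma \<pi>_y_shift_inj: "\<pi> (y_shift P g) = \<pi> (y_shift P h) \<Longrightarrow> g = h"
  by (rule y_shift_inj, rule \<pi>_inj, assumption) (rule mem)+

end

section \<open>Positive characteristic\<close>

text \<open>
  When \<open>p\<close> is the characteristic, this is the span of \<open>a 0, \<dots>, a (k - 1)\<close> over the prime field.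
\<close>
fun digit_span :: "nat \<Rightarrow> (nat \<Rightarrow> 'a::comm_ring_1) \<Rightarrow> nat \<Rightarrow> 'a set" where
  "digit_span p a 0 = {0}"
| "digit_span p a (Suc k) = (\<lambda>(u, n). u + of_nat n * a k) ` (digit_span p a k \<times> {..<p})"

lemma finite_digit_span: "finite (digit_span p a k)"
  by (induction k) auto

lemma digit_span_0: "0 < p \<Longrightarrow> 0 \<in> digit_span p a k"
  by (induction k) (auto intro!: image_eqI[of _ _ "(0, 0)"])

lemma digit_span_add:
  assumes p: "0 < p" "of_nat p = (0::'a::comm_ring_1)"
  shows "j < k \<Longrightarrow> u \<in> digit_span p a k \<Longrightarrow> u + a j \<in> digit_span p (a::nat \<Rightarrow> 'a) k"
proof (induction k arbitrary: u)
  case (Suc k)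
  then obtain v n where v: "u = v + of_nat n * a k" "v \<in> digit_span p a k" "n < p" by auto
  show ?case
  proof (cases "j = k")
    case True
    show ?thesis
    proof (cases "Suc n = p")
      case True
      \<comment> \<open>The digit \<open>p - 1\<close> wraps around to \<open>0\<close>, because \<open>p\<close> is zero in the ring.\<close>
      then have "of_nat n + 1 = (0::'a)" using p(2) by (metis add.commute of_nat_Suc)
      then have "of_nat n * a k + a k = 0" by (metis distrib_right mult_1 mult_zero_left)
      then have "u + a j = v + of_nat 0 * a k" using \<open>j = k\<close> v by (simp add: add.assoc)
      then show ?thesis using v(2) p by (auto intro!: image_eqI[of _ _ "(v, 0)"])
    next
      case False
      have "u + a j = v + of_nat (Suc n) * a k" using \<open>j = k\<close> v by (simp add: algebra_simps)
      then show ?thesis using v(2,3) False by (auto intro!: image_eqI[of _ _ "(v, Suc n)"])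
    qed
  next
    case False
    then have "v + a j \<in> digit_span p a k" using Suc v by auto
    moreover have "u + a j = (v + a j) + of_nat n * a k" using v by (simp add: algebra_simps)
    ultimately show ?thesis using v(3) by (auto intro!: image_eqI[of _ _ "(v + a j, n)"])
  qed
qed auto

lemma digit_span_degree:
  fixes a :: "nat \<Rightarrow> 'k::field poly"
  assumes "\<And>j. j < k \<Longrightarrow> degree (a j) < d" and "0 < d"
  shows "u \<in> digit_span p a k \<Longrightarrow> degree u < d"
  using assms
proof (induction k arbitrary: u)
  case (Suc k)
  then obtain v n where v: "u = v + of_nat n * a k" "v \<in> digit_span p a k" by auto
  have "degree v < d" using Suc v by auto
  moreover have "degree (of_nat n * a k) < d"
    using degree_mult_le[of "of_nat n" "a k"] Suc.prems(2)[of k] by (simp add: of_nat_poly)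
  ultimately show ?case using v(1) degree_add_le_max[of v "of_nat n * a k"] by simp
qed auto

text \<open>The additive polynomial of Ore with zero set \<open>E\<close>, when \<open>E\<close> is a finite additive group.\<close>
definition additive_product :: "'a::comm_ring_1 set \<Rightarrow> 'a poly"
  where "additive_product E = (\<Prod>u\<in>E. [:- u, 1:])"

lemma additive_product_invariant:
  assumes "finite E" "\<And>u. u \<in> E \<Longrightarrow> u + c \<in> E"
  shows "pcompose (additive_product E) [:- c, 1:] = additive_product E"
proof -
  have inj: "inj_on (\<lambda>u. u + c) E" by simp
  have im: "(\<lambda>u. u + c) ` E = E"
    by (rule endo_inj_surj) (use assms in auto)
  have "pcompose (additive_product E) [:- c, 1:] = (\<Prod>u\<in>E. [:- (u + c), 1:])"
    unfolding additive_product_def pcompose_prod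
    by (rule prod.cong) (auto simp: pcompose_pCons)
  also have "\<dots> = (\<Prod>u\<in>(\<lambda>u. u + c) ` E. [:- u, 1:])"
    using prod.reindex[OF inj, of "\<lambda>u. [:- u, 1:]"] by simp
  finally show ?thesis by (simp add: im additive_product_def)
qed

lemma additive_product_moved:
  fixes c :: "'a::idom"
  assumes "finite E" "0 \<in> E" "c \<notin> E"
  shows "pcompose (additive_product E) [:- c, 1:] \<noteq> additive_product E"
proof
  assume "pcompose (additive_product E) [:- c, 1:] = additive_product E"
  then have "poly (additive_product E) c = poly (additive_product E) 0"
    by (metis (no_types, lifting) poly_pcompose add.left_inverse mult_1_right poly_0 poly_pCons mult_zero_right add_0_right)
  also have "poly (additive_product E) 0 = 0"
    using assms by (auto simp: additive_product_def poly_prod)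
  finally show False
    using assms by (auto simp: additive_product_def poly_prod)
qed

text \<open>
  The orbit of \<open>(1, 0)\<close> under the matrix with rows \<open>(1 + P\<^sup>2, P)\<close> and \<open>(P, 1)\<close>, through which the product of the
  shears \<open>x \<mapsto> x + P y\<close> and \<open>y \<mapsto> y + P x\<close> acts on translations. A unipotent matrix would not do here:
  in positive characteristic its orbits are finite.
\<close>
fun orbit :: "'k::field poly \<Rightarrow> nat \<Rightarrow> 'k poly \<times> 'k poly" where
  "orbit P 0 = (1, 0)"
| "orbit P (Suc i) = (case orbit P i of (a, b) \<Rightarrow> (a + P * (b + P * a), b + P * a))"

lemma orbit_degree:
  assumes "0 < degree P"
  shows "fst (orbit P i) \<noteq> 0 \<and> degree (fst (orbit P i)) = 2 * i * degree P \<and>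
    degree (snd (orbit P i)) \<le> degree (fst (orbit P i))"
proof (induction i)
  case (Suc i)
  obtain a b where ab: "orbit P i = (a, b)" by force
  then have IH: "a \<noteq> 0" "degree a = 2 * i * degree P" "degree b \<le> degree a" using Suc by auto
  have P: "P \<noteq> 0" using assms by auto
  have 1: "degree (b + P * a) = degree P + degree a"
    using IH P assms by (subst degree_add_eq_right) (auto simp: degree_mult_eq)
  then have ne: "b + P * a \<noteq> 0" using assms by auto
  have 2: "degree (a + P * (b + P * a)) = degree P + (degree P + degree a)"
    using IH P assms 1 ne by (subst degree_add_eq_right) (auto simp: degree_mult_eq)
  then have "a + P * (b + P * a) \<noteq> 0" using assms by auto
  then show ?case using 1 2 IH by (simp add: ab algebra_simps)
qed simp

text \<open>
  The translations \<open>e i\<close> along the orbit satisfy a monic relation of degree \<open>D\<close> with central coefficients, so an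
  element commuting with the first \<open>D\<close> of them commutes with \<open>e D\<close>. The \<open>y\<close>-shift by the
  additive polynomial of their span is a counterexample, since \<open>a D\<close> has larger degree than
  everything in the span.
\<close>
lemma (in rep_mod) positive_characteristic_impossible:
  assumes p: "0 < p" "of_nat p = (0::'k)" and deg: "0 < degree P"
  shows False
proof -
  define s where "s = x_shear P \<otimes>\<^bsub>End_A3\<^esub> y_shift P [:0, 1:]"
  define s' where "s' = y_shift P (- [:0, 1:]) \<otimes>\<^bsub>End_A3\<^esub> x_shear (- P)"
  interpret E: Group.monoid "End_A3 :: ('k poly3 \<times> 'k poly3 \<times> 'k poly3) monoid" by (rule End_monoid)
  have sm: "s \<in> carrier (TAut_mod \<mm>)" "s' \<in> carrier (TAut_mod \<mm>)"
    unfolding s_def s'_def by (rule mem)+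
  have assoc: "(x \<otimes>\<^bsub>End_A3\<^esub> y) \<otimes>\<^bsub>End_A3\<^esub> z = x \<otimes>\<^bsub>End_A3\<^esub> (y \<otimes>\<^bsub>End_A3\<^esub> z)"
    for x y z :: "'k poly3 \<times> 'k poly3 \<times> 'k poly3"
    by (rule E.m_assoc) (rule End_carrier)+
  have unit: "x \<otimes>\<^bsub>End_A3\<^esub> \<one>\<^bsub>End_A3\<^esub> = x" "\<one>\<^bsub>End_A3\<^esub> \<otimes>\<^bsub>End_A3\<^esub> x = x"
    for x :: "'k poly3 \<times> 'k poly3 \<times> 'k poly3"
    by (simp_all add: End_carrier)
  have cancel: "y_shift P [:0, 1:] \<otimes>\<^bsub>End_A3\<^esub> (y_shift P (- [:0, 1:]) \<otimes>\<^bsub>End_A3\<^esub> z) = z" for z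
    by (simp only: assoc[symmetric] elementary_inverse unit)
  have ss': "s \<otimes>\<^bsub>End_A3\<^esub> s' = \<one>\<^bsub>End_A3\<^esub>"
    unfolding s_def s'_def by (simp only: assoc cancel elementary_inverse)
  define e where "e i = \<pi> (translation P (orbit P i))" for i
  obtain m where m: "m \<in> monic (\<lambda>y. \<pi> s * y * \<pi> s') D"
    "\<And>\<phi>. \<phi> \<in> carrier (TAut_mod \<mm>) \<Longrightarrow> m (\<pi> \<phi>) = 0"
    using \<pi>_integral[OF sm ss'] by blast
  have step: "\<pi> s * e i * \<pi> s' = e (Suc i)" for i
  proof -
    obtain a b where ab: "orbit P i = (a, b)" by force
    have "s \<otimes>\<^bsub>End_A3\<^esub> translation P (a, b) = translation P (orbit P (Suc i)) \<otimes>\<^bsub>End_A3\<^esub> s"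
      unfolding s_def assoc y_shift_x_translation
      by (simp only: assoc[symmetric] x_shear_translation ab orbit.simps prod.case)
    then have "\<pi> s * e i = e (Suc i) * \<pi> s"
      using \<pi>_mult[OF sm(1) mem(1)] \<pi>_mult[OF mem(1) sm(1)] by (metis e_def ab)
    moreover have "\<pi> s * \<pi> s' = 1" using \<pi>_mult[OF sm] ss' by (simp add: \<pi>_one)
    ultimately show ?thesis by (simp add: mult.assoc)
  qed
  have pow: "((\<lambda>y. \<pi> s * y * \<pi> s') ^^ i) (e 0) = e i" for i
    by (induction i) (simp_all add: step)
  interpret operator "\<lambda>y. \<pi> s * y * \<pi> s'" by (rule operator_conj)
  obtain c where c: "\<And>i. central (c i)"
    "\<And>v. m v = ((\<lambda>y. \<pi> s * y * \<pi> s') ^^ D) v + (\<Sum>i<D. c i * ((\<lambda>y. \<pi> s * y * \<pi> s') ^^ i) v)"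
    using monic_coeffs[OF m(1)] by blast
  have "e D + (\<Sum>i<D. c i * e i) = 0"
    using m(2)[OF mem(1)[of "orbit P 0"]] unfolding c(2) by (fold e_def) (simp add: pow)
  then have eD: "e D = - (\<Sum>i<D. c i * e i)" by (simp add: eq_neg_iff_add_eq_0)
  define a where "a i = P * fst (orbit P i)" for i
  define E where "E = digit_span p a D"
  have p': "of_nat p = (0::'k poly)" using p(2) by (simp add: of_nat_poly)
  define w where "w = \<pi> (y_shift P (additive_product E))"
  have fin: "finite E" unfolding E_def by (rule finite_digit_span)
  have move: "e i * w = \<pi> (y_shift P (pcompose (additive_product E) [:- a i, 1:])) * e i" for i
  proof -
    obtain x y where xy: "orbit P i = (x, y)" by force
    show ?thesis
      unfolding e_def w_def a_def xy fst_conv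
      by (simp only: \<pi>_mult[OF mem(1) mem(2), symmetric] \<pi>_mult[OF mem(2) mem(1), symmetric] translation_y_shift)
  qed
  have comm: "e i * w = w * e i" if "i < D" for i
  proof -
    have "pcompose (additive_product E) [:- a i, 1:] = additive_product E"
      by (rule additive_product_invariant[OF fin]) (unfold E_def, rule digit_span_add[OF p(1) p' that])
    then show ?thesis using move[of i] by (simp add: w_def)
  qed
  have "(\<Sum>i<D. c i * e i) * w = w * (\<Sum>i<D. c i * e i)"
  proof -
    have "c i * e i * w = w * (c i * e i)" if "i < D" for i
    proof -
      have "c i * e i * w = (c i * w) * e i" by (simp only: mult.assoc comm[OF that])
      also have "\<dots> = w * (c i * e i)"
        using c(1)[of i] by (simp only: central_def mult.assoc)
      finally show ?thesis .
    qed
    then show ?thesis by (simp add: sum_distrib_left sum_distrib_right)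
  qed
  then have commD: "e D * w = w * e D" by (simp add: eD)
  have "w = \<pi> (y_shift P (pcompose (additive_product E) [:- a D, 1:]))"
  proof -
    have inv: "e D * \<pi> (translation P (- orbit P D)) = 1"
      unfolding e_def by (simp only: \<pi>_mult[OF mem(1) mem(1), symmetric] elementary_inverse \<pi>_one)
    have "w * e D = \<pi> (y_shift P (pcompose (additive_product E) [:- a D, 1:])) * e D"
      using move[of D] commD by simp
    then have "w * (e D * \<pi> (translation P (- orbit P D))) =
        \<pi> (y_shift P (pcompose (additive_product E) [:- a D, 1:])) * (e D * \<pi> (translation P (- orbit P D)))"
      by (simp only: mult.assoc[symmetric])
    then show ?thesis by (simp add: inv)
  qed
  then have "additive_product E = pcompose (additive_product E) [:- a D, 1:]"
    unfolding w_def by (rule \<pi>_y_shift_inj)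
  moreover have "a D \<notin> E"
  proof
    assume "a D \<in> E"
    have da: "degree (a i) = degree P + 2 * i * degree P" for i
      using orbit_degree[OF deg, of i] deg P(2) by (simp add: a_def degree_mult_eq)
    have "degree (a D) < degree (a D)"
      using \<open>a D \<in> E\<close> deg unfolding E_def
      by (rule_tac digit_span_degree[of D a "degree (a D)" "a D" p]) (auto simp: da)
    then show False by simp
  qed
  ultimately show False
    using additive_product_moved[OF fin, of "a D"] digit_span_0[OF p(1), of a D] by (simp add: E_def)
qed

section \<open>Characteristic zero\<close>

text \<open>
  The leading term of the difference is that of \<open>c\<close> times the derivative, so differences lower
  degrees by exactly one in characteristic zero.
\<close>
lemma shift_difference:
  fixes g :: "'a::idom poly"
  assumes "degree g \<le> Suc n"
  shows "degree (pcompose g [:c, 1:] - g) \<le> n \<and>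
    coeff (pcompose g [:c, 1:] - g) n = of_nat (Suc n) * c * coeff g (Suc n)"
  using assms
proof (induction n arbitrary: g)
  case 0
  obtain a h where g: "g = pCons a h" by (cases g)
  then have "degree h = 0" using 0 by (auto split: if_splits)
  then obtain b where "h = [:b:]" by (rule degree_eq_zeroE)
  then show ?case by (simp add: g pcompose_pCons)
next
  case (Suc n)
  obtain a h where g: "g = pCons a h" by (cases g)
  then have h: "degree h \<le> Suc n" using Suc.prems by (auto split: if_splits)
  let ?h = "pcompose h [:c, 1:]"
  have deg: "degree ?h = degree h" by (simp add: degree_pcompose)
  have co: "coeff ?h (Suc n) = coeff h (Suc n)"
  proof (cases "degree h = Suc n")
    case True
    then show ?thesis using lead_coeff_comp[of "[:c, 1:]" h] deg by simp
  next
    case False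
    then show ?thesis using h deg by (simp add: coeff_eq_0)
  qed
  have eq: "pcompose g [:c, 1:] - g = pCons 0 (?h - h) + smult c ?h"
    by (simp add: g pcompose_pCons algebra_simps)
  have IH: "degree (?h - h) \<le> n" "coeff (?h - h) n = of_nat (Suc n) * c * coeff h (Suc n)"
    using Suc.IH[OF h] by auto
  show ?case unfolding eq
  proof
    show "degree (pCons 0 (?h - h) + smult c ?h) \<le> Suc n"
      using IH(1) h deg by (intro degree_add_le) (auto intro: order_trans[OF degree_smult_le])
    show "coeff (pCons 0 (?h - h) + smult c ?h) (Suc n) = of_nat (Suc (Suc n)) * c * coeff g (Suc (Suc n))"
      using IH(2) co by (simp add: g algebra_simps)
  qed
qed

lemma degree_shift_difference:
  fixes g :: "'a::idom poly"
  assumes "c \<noteq> 0" "of_nat (Suc n) \<noteq> (0::'a)" "degree g = Suc n"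
  shows "degree (pcompose g [:c, 1:] - g) = n"
proof -
  have "coeff g (Suc n) \<noteq> 0" using assms(3) by (metis leading_coeff_0_iff degree_0 nat.distinct(1))
  then have "coeff (pcompose g [:c, 1:] - g) n \<noteq> 0" using shift_difference[of g n c] assms by simp
  then show ?thesis using shift_difference[of g n c] assms(3) le_degree by (metis le_antisym order_refl)
qed

lemma pcompose_shift_pow:
  fixes c :: "'a::comm_ring_1"
  shows "((\<lambda>g. pcompose g [:c, 1:]) ^^ i) g = pcompose g [:of_nat i * c, 1:]"
proof (induction i)
  case (Suc i)
  then show ?case by (simp add: pcompose_pCons algebra_simps flip: pcompose_assoc)
qed (simp add: pcompose_idR)

text \<open>
  The shear provides the unipotent translation \<open>t\<close>: the commutator of its \<open>j\<close>-th power with a translation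
  in the direction of \<open>y\<close> is a translation in the direction of \<open>x\<close>, and the factor \<open>j\<close> is invertible in \<open>K\<close>.
  The polynomial \<open>h\<close> arises from a power of \<open>x\<close> by applying every operator \<open>U\<^sup>M - U\<^sup>i\<close>. These commute, so
  \<open>h\<close> lies in each of their images, and its degree remains large enough to survive the
  remaining \<open>q\<close> differences.
\<close>
lemma (in rep_mod) characteristic_zero_impossible:
  assumes char: "\<And>n. 0 < n \<Longrightarrow> of_nat n \<noteq> (0::'k)"
  shows False
proof -
  define s where "s = \<pi> (x_shear P)"
  define s' where "s' = \<pi> (x_shear (- P))"
  define S where "S = (\<lambda>(a, b). (a + P * b, b))"
  define S' where "S' = (\<lambda>(a, b). (a - P * b, b))"
  interpret B: normalized_rep "\<lambda>v. \<pi> (translation P v)" s s' S S'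
  proof
    show "\<pi> (translation P (v + w)) = \<pi> (translation P v) * \<pi> (translation P w)" for v w
      by (simp only: \<pi>_mult[OF mem(1) mem(1), symmetric] translation_mult)
    show "\<pi> (translation P 0) = 1" by (simp only: trivial_elementary \<pi>_one)
    show "s * s' = 1" "s' * s = 1"
      unfolding s_def s'_def
      by (simp_all only: \<pi>_mult[OF mem(3,4), symmetric] \<pi>_mult[OF mem(4,3), symmetric] elementary_inverse \<pi>_one)
    show "S (v + w) = S v + S w" "S (S' v) = v" "S' (S v) = v" for v w
      by (simp_all add: S_def S'_def algebra_simps split: prod.split)
    show "s * \<pi> (translation P v) = \<pi> (translation P (S v)) * s" for v
      by (cases v) (simp only: s_def S_def prod.case \<pi>_mult[OF mem(3,1), symmetric] \<pi>_mult[OF mem(1,3), symmetric] x_shear_translation)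
  qed
  define t where "t = \<pi> (translation P (P, 0))"
  obtain m where m: "m \<in> monic (\<lambda>y. s * y * s') D" "\<And>v. m (\<pi> (translation P v)) = 0"
    using \<pi>_integral[OF mem(3,4) elementary_inverse(5)] mem(1) unfolding s_def s'_def by blast
  have S_pow: "(S ^^ i) (a, b) = (a + of_nat i * P * b, b)" for i a b
    by (induction i) (simp_all add: S_def algebra_simps)
  have "(t - 1) ^ D = 0"
  proof -
    \<comment> \<open>The \<open>j\<close>-th power of the shear moves \<open>(0, b)\<close> by \<open>(j P b, 0)\<close>; here \<open>j = D - i\<close>.\<close>
    have "(S ^^ D) (0, [:inverse (of_nat (D - i)):]) = (P, 0) + (S ^^ i) (0, [:inverse (of_nat (D - i)):])"
      if "i < D" for i
    proof -
      have "(of_nat D - of_nat i) * inverse (of_nat (D - i)) = (1::'k)"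
        using char[of "D - i"] that by (simp add: of_nat_diff)
      then have "smult (of_nat D * inverse (of_nat (D - i))) P = P + smult (of_nat i * inverse (of_nat (D - i))) P"
        by (metis (no_types, lifting) add_diff_cancel_left' diff_add_cancel left_diff_distrib smult_1_left smult_add_left)
      then show ?thesis by (simp add: S_pow of_nat_poly mult.commute)
    qed
    from B.unipotent_product[OF m this]
    have "prod_list (map (\<lambda>i. \<pi> (translation P (P, 0)) - 1) [0..<D]) = 0" by simp
    then show ?thesis by (simp add: map_replicate_const t_def)
  qed
  note t = this
  define t' where "t' = \<pi> (translation P (- (P, 0)))"
  define c where "c = - (P * P)"
  define U where "U = (\<lambda>g. pcompose g [:c, 1:])"
  define U' where "U' = (\<lambda>g. pcompose g [:- c, 1:])"
  interpret A: normalized_rep "\<lambda>g. \<pi> (y_shift P g)" t t' U U'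
  proof
    show "\<pi> (y_shift P (g + h)) = \<pi> (y_shift P g) * \<pi> (y_shift P h)" for g h
      by (simp only: \<pi>_mult[OF mem(2) mem(2), symmetric] y_shift_mult)
    show "\<pi> (y_shift P 0) = 1" by (simp only: trivial_elementary \<pi>_one)
    show "t * t' = 1" "t' * t = 1"
      unfolding t_def t'_def
      by (simp_all only: \<pi>_mult[OF mem(1) mem(1), symmetric] elementary_inverse \<pi>_one)
    show "U (g + h) = U g + U h" for g h by (simp add: U_def pcompose_add)
    show "U (U' g) = g" "U' (U g) = g" for g
      by (simp_all add: U_def U'_def pcompose_pCons pcompose_idR flip: pcompose_assoc)
    show "t * \<pi> (y_shift P g) = \<pi> (y_shift P (U g)) * t" for g
      by (simp only: t_def U_def c_def \<pi>_mult[OF mem(1,2), symmetric] \<pi>_mult[OF mem(2,1), symmetric] translation_y_shift)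
  qed
  have c: "c \<noteq> 0" using P(2) by (simp add: c_def)
  have char': "of_nat n \<noteq> (0::'k poly)" if "0 < n" for n using char[OF that] by (simp add: of_nat_poly)
  have U_pow: "(U ^^ i) g = pcompose g [:of_nat i * c, 1:]" for i g
    unfolding U_def by (rule pcompose_shift_pow)
  define M where "M = 2 * D"
  define T where "T i g = (U ^^ M) g - (U ^^ i) g" for i g
  have T_degree: "degree (T i g) = n" if "i < M" "degree g = Suc n" for i g n
  proof -
    have "[:of_nat M * c, 1:] = pcompose [:of_nat (M - i) * c, 1:] [:of_nat i * c, 1:]"
      using that(1) by (simp add: pcompose_pCons algebra_simps of_nat_diff)
    then have "T i g = pcompose (pcompose g [:of_nat (M - i) * c, 1:] - g) [:of_nat i * c, 1:]"
      unfolding T_def U_pow by (simp add: pcompose_diff pcompose_assoc)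
    then have "degree (T i g) = degree (pcompose g [:of_nat (M - i) * c, 1:] - g)"
      by (simp add: degree_pcompose)
    also have "\<dots> = n"
      using that c char'[of "M - i"] char'[of "Suc n"] by (intro degree_shift_difference) simp_all
    finally show ?thesis .
  qed
  have U_add: "(U ^^ i) (g - h) = (U ^^ i) g - (U ^^ i) h" for i g h
    unfolding U_pow by (rule pcompose_diff)
  have U_comm: "(U ^^ i) ((U ^^ j) g) = (U ^^ j) ((U ^^ i) g)" for i j g
    by (metis comp_apply funpow_add add.commute)
  have T_comm: "T i (T j g) = T j (T i g)" for i j g
    unfolding T_def U_add by (simp add: algebra_simps U_comm[of i M] U_comm[of j M] U_comm[of i j])
  define W where "W k g = fold T [0..<k] g" for k g
  have W_Suc: "W (Suc k) g = T k (W k g)" for k g by (simp add: W_def)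
  have W_image: "\<exists>b. T i b = W k g" if "i < k" for i k g
    using that
  proof (induction k)
    case (Suc k)
    show ?case
    proof (cases "i = k")
      case True
      then show ?thesis using W_Suc by metis
    next
      case False
      then obtain b where "T i b = W k g" using Suc by auto
      then have "T i (T k b) = W (Suc k) g" by (simp add: W_Suc T_comm[of i k])
      then show ?thesis by blast
    qed
  qed simp
  have W_degree: "degree (W k g) = n" if "k \<le> M" "degree g = n + k" for k g n
    using that
  proof (induction k arbitrary: n)
    case 0 then show ?case by (simp add: W_def)
  next
    case (Suc k)
    then show ?case unfolding W_Suc by (intro T_degree) auto
  qed
  have D_degree: "degree (((\<lambda>g. U g - g) ^^ k) g) = n" if "degree g = n + k" for k g n
    using that
  proof (induction k arbitrary: n)
    case (Suc k)
    have "degree (((\<lambda>g. U g - g) ^^ k) g) = Suc n" using Suc by simp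
    then show ?case using c char'[of "Suc n"] unfolding U_def
      by (simp del: of_nat_Suc) (rule degree_shift_difference, simp_all)
  qed simp
  define q where "q = M * M"
  define h where "h = W M (monom 1 (Suc q + M))"
  have h: "degree h = Suc q" unfolding h_def by (rule W_degree) (simp_all add: degree_monom_eq)
  have "\<pi> (y_shift P (((\<lambda>g. U g - g) ^^ q) h)) = 1"
    unfolding q_def M_def
    by (rule A.nilpotent_action_bound[OF t]) (use W_image[of _ M] in \<open>simp add: h_def T_def M_def\<close>)
  also have "1 = \<pi> (y_shift P 0)" by (simp only: trivial_elementary \<pi>_one)
  finally have "((\<lambda>g. U g - g) ^^ q) h = 0" by (rule \<pi>_y_shift_inj)
  then show False using D_degree[of h 1 q] h by simp
qed

section \<open>Ideals of finite codimension\<close>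

lemma poly3_ring_simps:
  "carrier (poly3_ring :: 'k::field poly3 ring) = UNIV" "\<zero>\<^bsub>poly3_ring\<^esub> = (0 :: 'k poly3)"
  "\<one>\<^bsub>poly3_ring\<^esub> = (1 :: 'k poly3)" "(p :: 'k poly3) \<oplus>\<^bsub>poly3_ring\<^esub> q = p + q"
  "(p :: 'k poly3) \<otimes>\<^bsub>poly3_ring\<^esub> q = p * q"
  by (simp_all add: poly3_ring_def ring_of_type_algebra_def)

lemma constants_subfield: "subfield (range (const3 :: 'k::field \<Rightarrow> _)) poly3_ring"
proof -
  interpret cring "poly3_ring :: 'k poly3 ring"
    unfolding poly3_ring_def by (rule cring_from_type_algebra)
  have hom: "const3 (a + b) = const3 a + const3 b" "const3 (a * b) = const3 a * const3 b"
    "const3 0 = 0" "const3 1 = 1" "const3 (- a) = - const3 a" for a b :: 'k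
    by (simp_all add: const3_def pCons_one)
  have neg: "\<ominus>\<^bsub>poly3_ring\<^esub> p = - p" for p :: "'k poly3"
    by (rule minus_equality) (simp_all add: poly3_ring_simps)
  show ?thesis
  proof (rule subfieldI)
    show "subcring (range const3) (poly3_ring :: 'k poly3 ring)"
    proof (rule subcringI', rule subringI)
      show "range const3 \<subseteq> carrier (poly3_ring :: 'k poly3 ring)" by (simp add: poly3_ring_simps)
      show "\<one>\<^bsub>poly3_ring\<^esub> \<in> range (const3 :: 'k \<Rightarrow> _)" by (metis hom(4) poly3_ring_simps(3) rangeI)
      show "\<ominus>\<^bsub>poly3_ring\<^esub> h \<in> range const3" if "h \<in> range const3" for h :: "'k poly3"
        using that by (auto simp: neg hom(5)[symmetric])
      show "g \<otimes>\<^bsub>poly3_ring\<^esub> h \<in> range const3" "g \<oplus>\<^bsub>poly3_ring\<^esub> h \<in> range const3"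
        if "g \<in> range const3" "h \<in> range const3" for g h :: "'k poly3"
        using that by (auto simp: poly3_ring_simps hom[symmetric])
    qed
    show "Units (poly3_ring\<lparr>carrier := range const3\<rparr>) = range (const3 :: 'k \<Rightarrow> _) - {\<zero>\<^bsub>poly3_ring\<^esub>}"
    proof (intro equalityI subsetI)
      fix p :: "'k poly3" assume "p \<in> Units (poly3_ring\<lparr>carrier := range const3\<rparr>)"
      then show "p \<in> range const3 - {\<zero>\<^bsub>poly3_ring\<^esub>}"
        by (auto simp: Units_def poly3_ring_simps)
    next
      fix p :: "'k poly3" assume "p \<in> range const3 - {\<zero>\<^bsub>poly3_ring\<^esub>}"
      then obtain c where c: "p = const3 c" "c \<noteq> 0" using hom(3) by (auto simp: poly3_ring_simps)
      have "const3 c * const3 (inverse c) = 1" "const3 (inverse c) * const3 c = 1"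
        using c(2) by (simp_all add: hom(2,4)[symmetric])
      then show "p \<in> Units (poly3_ring\<lparr>carrier := range const3\<rparr>)"
        unfolding Units_def c(1) by (auto simp: poly3_ring_simps)
    qed
  qed
qed

text \<open>
  A linear combination of the cosets of \<open>z\<^sup>k, z\<^bsup>k+1\<^esup>, \<dots>\<close> is the coset of the polynomial with these
  coefficients.
\<close>
lemma combine_coset_powers:
  assumes "ring_hom_ring (poly3_ring :: 'k::field poly3 ring) Q h"
  shows "ring.combine Q (map (\<lambda>c. h (const3 c)) cs) (map (\<lambda>i. h (var_z ^ i)) [k..<k + length cs])
    = h ([:[:[:0, 1:] ^ k * Poly cs:]:])"
proof (induction cs arbitrary: k)
  interpret H: ring_hom_ring poly3_ring Q h by fact
  case Nil
  show ?case using H.hom_zero by (simp add: H.S.combine.simps poly3_ring_simps)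
next
  interpret H: ring_hom_ring poly3_ring Q h by fact
  case (Cons c cs)
  have z: "var_z ^ k = [:[:[:0, 1:] ^ k:]:]" for k :: nat
    by (induction k) (simp_all add: var_z_def pCons_one)
  have "[k..<k + length (c # cs)] = k # [Suc k..<Suc k + length cs]" by (subst upt_conv_Cons) (simp_all del: upt_Suc)
  then have "ring.combine Q (map (\<lambda>c. h (const3 c)) (c # cs)) (map (\<lambda>i. h (var_z ^ i)) [k..<k + length (c # cs)])
    = h (const3 c) \<otimes>\<^bsub>Q\<^esub> h (var_z ^ k) \<oplus>\<^bsub>Q\<^esub> h ([:[:[:0, 1:] ^ Suc k * Poly cs:]:])"
    by (simp only: list.map H.S.combine.simps Cons.IH)
  also have "\<dots> = h (const3 c * var_z ^ k + [:[:[:0, 1:] ^ Suc k * Poly cs:]:])"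
    using H.hom_mult[of "const3 c" "var_z ^ k"] H.hom_add[of "const3 c * var_z ^ k" "[:[:[:0, 1:] ^ Suc k * Poly cs:]:]"]
    by (simp only: poly3_ring_simps UNIV_I)
  also have "const3 c * var_z ^ k + [:[:[:0, 1:] ^ Suc k * Poly cs:]:] = [:[:[:0, 1:] ^ k * Poly (c # cs):]:]"
    by (simp add: z const3_def algebra_simps)
  finally show ?case .
qed

text \<open>
  More powers of \<open>z\<close> than the codimension are linearly dependent modulo \<open>\<mm>\<close>. The extra factor \<open>z\<close>
  makes the degree positive. The unit ideal is treated apart because its quotient has no
  subfield.
\<close>
lemma finite_codim_z_polynomial:
  fixes \<mm> :: "'k::field poly3 set"
  assumes ideal: "ideal \<mm> poly3_ring" and fin: "finite_codim \<mm>"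
  obtains P where "0 < degree P" "[:[:P:]:] \<in> \<mm>"
proof -
  interpret ideal \<mm> "poly3_ring :: 'k poly3 ring" by fact
  define Q where "Q = poly3_ring Quot \<mm>"
  define h where "h = (\<lambda>p. \<mm> +>\<^bsub>poly3_ring\<^esub> p)"
  have "\<exists>P. P \<noteq> 0 \<and> [:[:P:]:] \<in> \<mm>"
  proof (cases "1 \<in> \<mm>")
    case True
    then show ?thesis by (intro exI[of _ 1]) (simp add: pCons_one)
  next
    case False
    have hom: "ring_hom_ring poly3_ring Q h" unfolding Q_def h_def by (rule rcos_ring_hom_ring)
    interpret H: ring_hom_ring poly3_ring Q h by fact
    have zero: "h p = \<zero>\<^bsub>Q\<^esub> \<longleftrightarrow> p \<in> \<mm>" for p
    proof
      assume "h p = \<zero>\<^bsub>Q\<^esub>"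
      moreover have "p \<in> \<mm> +>\<^bsub>poly3_ring\<^esub> p" by (rule a_rcos_self) (simp add: poly3_ring_simps)
      ultimately show "p \<in> \<mm>" by (simp add: h_def Q_def FactRing_def)
    next
      assume "p \<in> \<mm>"
      then show "h p = \<zero>\<^bsub>Q\<^esub>" using a_coset_join2[of p \<mm>] additive_subgroup.a_subgroup[OF is_additive_subgroup]
        by (simp add: h_def Q_def FactRing_def poly3_ring_simps)
    qed
    have one: "\<one>\<^bsub>Q\<^esub> \<noteq> \<zero>\<^bsub>Q\<^esub>"
      using zero[of 1] H.hom_one False by (simp add: poly3_ring_simps)
    define K where "K = h ` range const3"
    have K: "subfield K Q" unfolding K_def by (rule H.img_is_subfield(2)[OF constants_subfield one])
    have "ring.finite_dimension Q K (carrier Q)"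
      using fin by (simp add: finite_codim_def Q_def K_def h_def image_image)
    then obtain n where n: "ring.dimension Q n K (carrier Q)"
      unfolding H.S.finite_dimension_def by blast
    define Us where "Us = map (\<lambda>i. h (var_z ^ i)) [0..<Suc n]"
    have Us: "set Us \<subseteq> carrier Q"
      using H.hom_closed by (auto simp: Us_def poly3_ring_simps)
    have "\<not> ring.independent Q K Us"
      using H.S.independent_length_le_dimension[OF K n _ Us] by (auto simp: Us_def)
    then obtain Ks where Ks: "length Ks = length Us" "ring.combine Q Ks Us = \<zero>\<^bsub>Q\<^esub>" "set Ks \<subseteq> K"
      "set Ks \<noteq> {\<zero>\<^bsub>Q\<^esub>}"
      using H.S.dependent_imp_non_trivial_combine[OF K Us] by metis
    have "\<exists>cs. Ks = map (\<lambda>c. h (const3 c)) cs"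
      unfolding ex_map_conv using Ks(3) by (auto simp: K_def)
    then obtain cs where cs: "Ks = map (\<lambda>c. h (const3 c)) cs" by blast
    have len: "length cs = Suc n" using Ks(1) cs by (simp add: Us_def)
    have "h [:[:Poly cs:]:] = \<zero>\<^bsub>Q\<^esub>"
      using combine_coset_powers[OF hom, of cs 0] Ks(2) cs len by (simp add: Us_def)
    then have "[:[:Poly cs:]:] \<in> \<mm>" by (simp add: zero)
    moreover have "Poly cs \<noteq> 0"
    proof
      assume "Poly cs = 0"
      then have "set cs \<subseteq> {0}" by (simp add: Poly_eq_0) (metis in_set_replicate subsetI singletonI)
      then have "set Ks \<subseteq> {\<zero>\<^bsub>Q\<^esub>}" using H.hom_zero by (auto simp: cs const3_def poly3_ring_simps)
      then show False using Ks(4) len cs by (auto simp: subset_singleton_iff)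
    qed
    ultimately show ?thesis by blast
  qed
  then obtain P where P: "P \<noteq> 0" "[:[:P:]:] \<in> \<mm>" by auto
  show thesis
  proof (rule that)
    show "0 < degree ([:0, 1:] * P)" using P(1) by (simp add: degree_mult_eq)
    have "[:[:[:0, 1:] * P:]:] = [:[:P:]:] * var_z" by (simp add: var_z_def mult.commute)
    then show "[:[:[:0, 1:] * P:]:] \<in> \<mm>" using multiple_mem[OF ideal P(2), of var_z] by (simp only:)
  qed
qed

section \<open>Nonlinearity\<close>

text \<open>
  The elementary maps attached to a single polynomial \<open>P\<close> in \<open>\<mm>\<close> already rule out \<open>\<rho>\<close>; the characteristic of \<open>K\<close> decides which of the two obstructions applies.
\<close>
lemma TAut_mod_not_linear:
  fixes \<mm> :: "'k::field poly3 set" and R :: "('r, 'b) ring_scheme"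
  assumes ideal: "ideal \<mm> poly3_ring" and "finite_codim \<mm>" and R: "cring R"
  shows "\<rho> \<notin> mon (TAut_mod \<mm>) (GL n R)"
proof
  assume \<rho>: "\<rho> \<in> mon (TAut_mod \<mm>) (GL n R)"
  obtain P where degree: "0 < degree P" and member: "[:[:P:]:] \<in> \<mm>"
    using finite_codim_z_polynomial[OF assms(1,2)] .
  have one: "\<one>\<^bsub>TAut_mod \<mm>\<^esub> \<in> carrier (TAut_mod \<mm>)"
    using elementary_mem(1)[OF ideal member, of 0] by (simp add: trivial_elementary Aut_simps)
  have idem: "\<one>\<^bsub>TAut_mod \<mm>\<^esub> \<otimes>\<^bsub>TAut_mod \<mm>\<^esub> \<one>\<^bsub>TAut_mod \<mm>\<^esub> = \<one>\<^bsub>TAut_mod \<mm>\<^esub>"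
    using monoid.l_one[OF End_monoid End_carrier] by (simp add: Aut_simps)
  obtain \<pi> :: "'k poly3 \<times> 'k poly3 \<times> 'k poly3 \<Rightarrow> (nat \<times> nat \<Rightarrow> 'r) all_rings" and D
    where rep: "linear_rep (TAut_mod \<mm>) \<pi> D"
    by (rule linear_rep_of_matrices[OF R one idem \<rho>])
  have "P \<noteq> 0" using degree by auto
  interpret rep_mod \<mm> P \<pi> D
    by (rule rep_mod.intro) fact+
  show False
  proof (cases "\<exists>p>0. of_nat p = (0::'k)")
    case True
    then obtain p where "0 < p" "of_nat p = (0::'k)" by blast
    then show ?thesis using degree by (rule positive_characteristic_impossible)
  next
    case False
    then have "of_nat p \<noteq> (0::'k)" if "0 < p" for p using that by blast
    then show ?thesis by (rule characteristic_zero_impossible)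
  qed
qed

theorem theoremB:
  fixes \<mm> :: "'k::field poly3 set"
    and R :: "('r, 'b) ring_scheme"
    and n :: nat
  assumes "ideal \<mm> poly3_ring"
    and "finite_codim \<mm>"
    and "cring R"
    and "n \<ge> 1"
  shows "\<not> (\<exists>\<rho>. \<rho> \<in> mon (Aut_mod \<mm>) (GL n R)) \<and> \<not> (\<exists>\<rho>. \<rho> \<in> mon (TAut_mod \<mm>) (GL n R))"
proof -
  have carriers: "carrier (TAut_mod \<mm>) \<subseteq> carrier (Aut_mod \<mm>)"
    by (simp add: Aut_mod_def TAut_mod_def)
  have mult: "monoid.mult (TAut_mod \<mm>) = monoid.mult (Aut_mod \<mm>)"
    by (simp add: Aut_mod_def TAut_mod_def)
  have "\<rho> \<in> mon (TAut_mod \<mm>) (GL n R)" if "\<rho> \<in> mon (Aut_mod \<mm>) (GL n R)" for \<rho>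
  proof -
    have hom: "\<rho> \<in> hom (Aut_mod \<mm>) (GL n R)" and inj: "inj_on \<rho> (carrier (Aut_mod \<mm>))"
      using that by (simp_all add: mon_def)
    have "\<rho> \<in> hom (TAut_mod \<mm>) (GL n R)"
      using hom carriers unfolding hom_def mult by blast
    then show ?thesis using inj_on_subset[OF inj carriers] by (simp add: mon_def)
  qed
  then show ?thesis using TAut_mod_not_linear[OF assms(1-3)] by blast
qed

end
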